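(* Let $n\ge1$ and let $C=\mathcal{O}(1)$ be a constant. In the real vector search problem, one is given vectors $x_1,\ldots,x_C\in\mathbb{C}^{2^n}$ where, for one unknown index $k^*\in\{1,\ldots,C\}$, $x_{k^*}$ is sampled uniformly from the real unit sphere $\{x\in\mathbb{R}^{2^n}:\|x\|_2=1\}$ and each $x_i$ with $i\ne k^*$ is sampled (independently) uniformly from the complex unit sphere $\{x\in\mathbb{C}^{2^n}:\|x\|_2=1\}$; the goal is to identify $k^*$. Any quantum algorithm that has access to copies of the $n$-qubit states $|x_1\rangle,\ldots,|x_C\rangle$ (where $|x\rangle=\sum_i x_i|i\rangle$) requires $\Omega(2^{n/2})$ time to solve the real vector search problem.
   Context: A quantum algorithm with quantum state inputs may request any number of copies of each state $|x_1\rangle,\ldots,|x_C\rangle$, each copy having unit cost, and may then perform arbitrary quantum operations and measurements; its running time is at least the total number of copies it uses. "Solving" the problem means outputting the correct index $k^*$ with probability at least $0.9$, where the probability is over the random sampling of the vectors and the randomness of the algorithm, for each possible value of $k^*$. *)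

theory Defs
  imports "HOL-Probability.Probability"
begin

definition real_space :: "nat \<Rightarrow> (nat \<Rightarrow> real) measure" where
  "real_space d = PiM {..<d} (\<lambda>_. lborel)"

definition cplx_space :: "nat \<Rightarrow> (nat \<Rightarrow> complex) measure" where
  "cplx_space d = PiM {..<d} (\<lambda>_. lborel)"

text \<open>Uniform (normalized surface) measure on the unit sphere: push forward of the
  uniform measure on the open unit ball under x \<mapsto> x / norm x.\<close>

definition unif_sphere_real :: "nat \<Rightarrow> (nat \<Rightarrow> real) measure" where
  "unif_sphere_real d =
     distr (uniform_measure (real_space d) {x \<in> space (real_space d). (\<Sum>i<d. (x i)\<^sup>2) < 1})
           (real_space d)
           (\<lambda>x. restrict (\<lambda>i. x i / sqrt (\<Sum>j<d. (x j)\<^sup>2)) {..<d})"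

definition unif_sphere_cplx :: "nat \<Rightarrow> (nat \<Rightarrow> complex) measure" where
  "unif_sphere_cplx d =
     distr (uniform_measure (cplx_space d) {x \<in> space (cplx_space d). (\<Sum>i<d. (cmod (x i))\<^sup>2) < 1})
           (cplx_space d)
           (\<lambda>x. restrict (\<lambda>i. x i / complex_of_real (sqrt (\<Sum>j<d. (cmod (x j))\<^sup>2))) {..<d})"

definition unif_sphere_real_in_cplx :: "nat \<Rightarrow> (nat \<Rightarrow> complex) measure" where
  "unif_sphere_real_in_cplx d =
     distr (unif_sphere_real d) (cplx_space d) (\<lambda>x. restrict (\<lambda>i. complex_of_real (x i)) {..<d})"

definition input_dist :: "nat \<Rightarrow> nat \<Rightarrow> nat \<Rightarrow> (nat \<Rightarrow> nat \<Rightarrow> complex) measure" where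
  "input_dist C d k = PiM {1..C} (\<lambda>i. if i = k then unif_sphere_real_in_cplx d else unif_sphere_cplx d)"

text \<open>Computational basis of (C^d)^{\<otimes>M}: index tuples of length M with entries < d.\<close>
definition basis_idx :: "nat \<Rightarrow> nat \<Rightarrow> nat list set" where
  "basis_idx M d = {js. length js = M \<and> set js \<subseteq> {..<d}}"

text \<open>The product state |x_{s_1}> \<otimes> ... \<otimes> |x_{s_M}>, where s lists which input each copy is of.\<close>
definition copies_state :: "nat list \<Rightarrow> (nat \<Rightarrow> nat \<Rightarrow> complex) \<Rightarrow> nat list \<Rightarrow> complex" where
  "copies_state s X js = (\<Prod>t<length s. X (s ! t) (js ! t))"

definition is_povm :: "nat list set \<Rightarrow> nat \<Rightarrow> (nat \<Rightarrow> nat list \<Rightarrow> nat list \<Rightarrow> complex) \<Rightarrow> bool" where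
  "is_povm I C E \<longleftrightarrow>
     (\<forall>k\<in>{1..C}. \<forall>a\<in>I. \<forall>b\<in>I. E k a b = cnj (E k b a)) \<and>
     (\<forall>k\<in>{1..C}. \<forall>v. 0 \<le> Re (\<Sum>a\<in>I. \<Sum>b\<in>I. cnj (v a) * E k a b * v b)) \<and>
     (\<forall>a\<in>I. \<forall>b\<in>I. (\<Sum>k\<in>{1..C}. E k a b) = (if a = b then 1 else 0))"

definition outcome_prob :: "nat list set \<Rightarrow> (nat \<Rightarrow> nat list \<Rightarrow> nat list \<Rightarrow> complex) \<Rightarrow> nat
     \<Rightarrow> (nat list \<Rightarrow> complex) \<Rightarrow> real" where
  "outcome_prob I E k psi = Re (\<Sum>a\<in>I. \<Sum>b\<in>I. cnj (psi a) * E k a b * psi b)"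

text \<open>Success probability of the algorithm (copy list s, POVM E) when the special index is k.\<close>
definition success_prob :: "nat \<Rightarrow> nat \<Rightarrow> nat list \<Rightarrow> (nat \<Rightarrow> nat list \<Rightarrow> nat list \<Rightarrow> complex) \<Rightarrow> nat \<Rightarrow> real" where
  "success_prob C n s E k =
     (\<integral>X. outcome_prob (basis_idx (length s) (2^n)) E k (copies_state s X) \<partial>input_dist C (2^n) k)"

end

(* Averaging over the inputs replaces the algorithm's state by a density matrix rho. Call a basis
   tuple collision-free if different copies of the same input vector carry different coordinates.
   By invariance under sign flips, rho has no entries between collision-free and other tuples, and
   an entry between two collision-free tuples vanishes unless they agree up to permuting copies of
   the same vector; by invariance under coordinate transpositions all remaining entries of that
   block equal one constant W. Hence the collision-free blocks for different special indices are
   proportional. By the bound 3/d on the sum of the fourth moments of the coordinates of a unit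
   vector in dimension d, the block has trace at least 1 - 3 M^2 / d when M copies are used. Two
   measurement outcomes that each succeed with probability 0.9 cannot share a common part of trace
   larger than 0.2, which forces M^2 to be of order d. *)
theory Submission
  imports Defs
begin

text \<open>Up to scale, the averaged states of a real and of a complex vector differ only through
  collisions: between the tuples \<open>jj\<close> and \<open>kk\<close> the entry is the mean of
  \<open>cnj (x j)^2 * (x k)^2\<close>, which is positive on the real sphere and zero on the complex
  one. What remains is to see how rare collisions are. Exact moments of either sphere are avoided.
  Everything comes from reflections of two coordinates with real coefficients, which act on real and
  complex vectors alike, so that one argument serves every special index. The price is that W is
  never computed and can vary with the special index. The comparison therefore runs through a
  quantity free of the distribution: the sum of the entries of a measurement operator over pairs of
  collision-free tuples that agree up to permuting copies. The exact sums of fourth moments, 3/(d+2)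
  and 2/(d+1), both lie below 3/d. The threshold 0.2 is twice the allowed failure probability 0.1.
  An algorithm appears as a list of copies with one joint measurement, and its time is at least the
  length of the list.\<close>

text \<open>With \<open>c\<^sup>2 + s\<^sup>2 = 1\<close> this family contains the three symmetries needed below: sign flips
  (\<open>c = 1, s = 0\<close>), transpositions (\<open>c = 0, s = 1\<close>) and Hadamard mixings (\<open>c = s = 1 / sqrt 2\<close>).\<close>
definition plane_refl :: "'i \<Rightarrow> 'i \<Rightarrow> real \<Rightarrow> real \<Rightarrow> ('i \<Rightarrow> 'a::real_vector) \<Rightarrow> 'i \<Rightarrow> 'a" where
  "plane_refl i j c s x = x(i := c *\<^sub>R x i + s *\<^sub>R x j, j := s *\<^sub>R x i - c *\<^sub>R x j)"

section \<open>Invariance of product Lebesgue measure under plane reflections\<close>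

lemma nn_integral_lborel_affine:
  fixes f :: "'a::euclidean_space \<Rightarrow> ennreal"
  assumes [measurable]: "f \<in> borel_measurable borel" and "c \<noteq> 0"
  shows "(\<integral>\<^sup>+x. f x \<partial>lborel) = ennreal (\<bar>c\<bar> ^ DIM('a)) * (\<integral>\<^sup>+x. f (t + c *\<^sub>R x) \<partial>lborel)"
  by (subst lborel_affine[OF assms(2), of t])
    (simp add: nn_integral_density nn_integral_distr nn_integral_cmult)

text \<open>For nonzero \<open>c\<close> the reflection is a composition of two affine
  substitutions, each changing one variable while the other is fixed; their Jacobian factors are
  inverse to each other. For \<open>c = 0\<close> it is a swap of the variables up to a common
  sign.\<close>

lemma nn_integral_lborel_plane_refl:
  fixes f :: "'a::euclidean_space \<times> 'a \<Rightarrow> ennreal"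
  assumes [measurable]: "f \<in> borel_measurable (lborel \<Otimes>\<^sub>M lborel)" and cs: "c\<^sup>2 + s\<^sup>2 = 1"
  shows "(\<integral>\<^sup>+x. \<integral>\<^sup>+y. f (c *\<^sub>R x + s *\<^sub>R y, s *\<^sub>R x - c *\<^sub>R y) \<partial>lborel \<partial>lborel)
       = (\<integral>\<^sup>+x. \<integral>\<^sup>+y. f (x, y) \<partial>lborel \<partial>lborel)"
proof (cases "c = 0")
  case True
  with cs have s: "s \<noteq> 0" and s1: "\<bar>s\<bar> = 1"
    by (auto simp: power2_eq_1_iff)
  have "(\<integral>\<^sup>+x. \<integral>\<^sup>+y. f (x, y) \<partial>lborel \<partial>lborel) = (\<integral>\<^sup>+x. \<integral>\<^sup>+y. f (s *\<^sub>R x, y) \<partial>lborel \<partial>lborel)"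
    by (subst nn_integral_lborel_affine[OF _ s, of _ 0]) (simp_all add: s1)
  also have "\<dots> = (\<integral>\<^sup>+x. \<integral>\<^sup>+y. f (s *\<^sub>R x, s *\<^sub>R y) \<partial>lborel \<partial>lborel)"
    by (rule nn_integral_cong, subst nn_integral_lborel_affine[OF _ s, of _ 0]) (simp_all add: s1)
  also have "\<dots> = (\<integral>\<^sup>+y. \<integral>\<^sup>+x. f (s *\<^sub>R x, s *\<^sub>R y) \<partial>lborel \<partial>lborel)"
    by (rule lborel_pair.Fubini'[symmetric]) measurable
  finally show ?thesis
    using True by simp
next
  case False
  then have c': "- 1 / c \<noteq> 0" by simp
  \<comment> \<open>The second component after both substitutions; it collapses because
    \<open>s\<^sup>2 - 1 = - c\<^sup>2\<close>.\<close>
  have eq: "(s / c) *\<^sub>R (c *\<^sub>R x + s *\<^sub>R y) - (1 / c) *\<^sub>R y = s *\<^sub>R x - c *\<^sub>R y" for x y :: 'a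
  proof -
    have "s * s / c - 1 / c = - c"
      using cs False by (simp add: field_simps power2_eq_square)
    then have "(s * s / c) *\<^sub>R y - (1 / c) *\<^sub>R y = - c *\<^sub>R y"
      by (metis scaleR_left_diff_distrib)
    then show ?thesis
      using False by (simp add: scaleR_add_right)
  qed
  have "(\<integral>\<^sup>+x. \<integral>\<^sup>+y. f (x, y) \<partial>lborel \<partial>lborel)
      = (\<integral>\<^sup>+x. ennreal (\<bar>-1/c\<bar> ^ DIM('a)) * (\<integral>\<^sup>+y. f (x, (s / c) *\<^sub>R x + (-1/c) *\<^sub>R y) \<partial>lborel) \<partial>lborel)"
    by (intro nn_integral_cong nn_integral_lborel_affine c') measurable
  also have "\<dots> = ennreal (\<bar>-1/c\<bar> ^ DIM('a)) * (\<integral>\<^sup>+x. \<integral>\<^sup>+y. f (x, (s / c) *\<^sub>R x + (-1/c) *\<^sub>R y) \<partial>lborel \<partial>lborel)"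
    by (rule nn_integral_cmult) measurable
  also have "(\<integral>\<^sup>+x. \<integral>\<^sup>+y. f (x, (s / c) *\<^sub>R x + (-1/c) *\<^sub>R y) \<partial>lborel \<partial>lborel)
      = (\<integral>\<^sup>+y. \<integral>\<^sup>+x. f (x, (s / c) *\<^sub>R x + (-1/c) *\<^sub>R y) \<partial>lborel \<partial>lborel)"
    by (rule lborel_pair.Fubini'[symmetric]) measurable
  also have "\<dots> = (\<integral>\<^sup>+y. ennreal (\<bar>c\<bar> ^ DIM('a)) *
      (\<integral>\<^sup>+x. f (s *\<^sub>R y + c *\<^sub>R x, (s / c) *\<^sub>R (s *\<^sub>R y + c *\<^sub>R x) + (-1/c) *\<^sub>R y) \<partial>lborel) \<partial>lborel)"
    by (intro nn_integral_cong nn_integral_lborel_affine False) measurable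
  also have "\<dots> = (\<integral>\<^sup>+y. ennreal (\<bar>c\<bar> ^ DIM('a)) * (\<integral>\<^sup>+x. f (c *\<^sub>R x + s *\<^sub>R y, s *\<^sub>R x - c *\<^sub>R y) \<partial>lborel) \<partial>lborel)"
    using eq by (simp add: add.commute)
  also have "\<dots> = ennreal (\<bar>c\<bar> ^ DIM('a)) * (\<integral>\<^sup>+y. \<integral>\<^sup>+x. f (c *\<^sub>R x + s *\<^sub>R y, s *\<^sub>R x - c *\<^sub>R y) \<partial>lborel \<partial>lborel)"
    by (rule nn_integral_cmult) measurable
  also have "ennreal (\<bar>-1/c\<bar> ^ DIM('a)) * \<dots> = (\<integral>\<^sup>+y. \<integral>\<^sup>+x. f (c *\<^sub>R x + s *\<^sub>R y, s *\<^sub>R x - c *\<^sub>R y) \<partial>lborel \<partial>lborel)"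
    using False by (simp add: mult.assoc[symmetric] ennreal_mult[symmetric] power_mult_distrib[symmetric])
  also have "\<dots> = (\<integral>\<^sup>+x. \<integral>\<^sup>+y. f (c *\<^sub>R x + s *\<^sub>R y, s *\<^sub>R x - c *\<^sub>R y) \<partial>lborel \<partial>lborel)"
    by (rule lborel_pair.Fubini') measurable
  finally show ?thesis ..
qed

abbreviation lborel_PiM :: "'i set \<Rightarrow> ('i \<Rightarrow> 'a::euclidean_space) measure" where
  "lborel_PiM I \<equiv> PiM I (\<lambda>_. lborel)"

lemma lborel_PiM_component_measurable:
  "k \<in> I \<Longrightarrow> (\<lambda>x. x k) \<in> borel_measurable (lborel_PiM I :: ('i \<Rightarrow> 'a::euclidean_space) measure)"
  using measurable_component_singleton[of k I "\<lambda>_. lborel :: 'a measure"] by simp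

lemma plane_refl_measurable:
  fixes I :: "'i set"
  assumes "i \<in> I" "j \<in> I"
  shows "plane_refl i j c s \<in> measurable (lborel_PiM I :: ('i \<Rightarrow> 'a::euclidean_space) measure) (lborel_PiM I)"
proof -
  have [measurable]: "(\<lambda>x. x k) \<in> borel_measurable (lborel_PiM I :: ('i \<Rightarrow> 'a) measure)" if "k \<in> I" for k
    using that by (rule lborel_PiM_component_measurable)
  have "insert i I = I" "insert j I = I" using assms by auto
  then show ?thesis
    using assms unfolding plane_refl_def
    by (intro measurable_fun_upd[where I=I and J=I]) auto
qed

text \<open>Fubini isolates the coordinates \<open>i\<close> and \<open>j\<close> with all others
  frozen, which leaves the planar statement.\<close>

lemma distr_lborel_PiM_plane_refl:
  fixes I :: "'i set"
  assumes "finite I" "i \<in> I" "j \<in> I" "i \<noteq> j" "c\<^sup>2 + s\<^sup>2 = 1"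
  shows "distr (lborel_PiM I) (lborel_PiM I) (plane_refl i j c s) = (lborel_PiM I :: ('i \<Rightarrow> 'a::euclidean_space) measure)"
    (is "distr ?M _ ?T = _")
proof (rule measure_eqI)
  note [measurable] = plane_refl_measurable[OF assms(2,3)]
  interpret product_sigma_finite "\<lambda>_::'i. lborel :: 'a measure" ..
  define J where "J = I - {i, j}"
  have J: "finite J" "j \<notin> J" "i \<notin> insert j J" and I: "I = insert i (insert j J)"
    using assms by (auto simp: J_def)
  have upd: "(\<lambda>p. z(i := fst p, j := snd p)) \<in> measurable (lborel \<Otimes>\<^sub>M lborel) ?M"
    if z: "z \<in> space (lborel_PiM J)" for z :: "'i \<Rightarrow> 'a"
  proof -
    have "(\<lambda>p. z(i := fst p, j := snd p)) \<in> measurable (lborel \<Otimes>\<^sub>M lborel) (lborel_PiM (insert j (insert i J)))"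
      using z by (intro measurable_fun_upd[where J="insert i J"] measurable_fun_upd[where J=J]) auto
    then show ?thesis
      using I by (simp add: insert_commute)
  qed
  have split: "(\<integral>\<^sup>+x. f x \<partial>?M) = (\<integral>\<^sup>+z. \<integral>\<^sup>+x. \<integral>\<^sup>+y. f (z(i := x, j := y)) \<partial>lborel \<partial>lborel \<partial>lborel_PiM J)"
    if f[measurable]: "f \<in> borel_measurable ?M" for f
  proof -
    have "(\<integral>\<^sup>+x. f x \<partial>?M) = (\<integral>\<^sup>+z. \<integral>\<^sup>+y. \<integral>\<^sup>+x. f (z(j := y, i := x)) \<partial>lborel \<partial>lborel \<partial>lborel_PiM J)"
      using J f unfolding I
      by (subst product_nn_integral_insert) (simp_all, subst product_nn_integral_insert, auto)
    also have "\<dots> = (\<integral>\<^sup>+z. \<integral>\<^sup>+y. \<integral>\<^sup>+x. f (z(i := x, j := y)) \<partial>lborel \<partial>lborel \<partial>lborel_PiM J)"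
      using assms(4) by (simp add: fun_upd_twist)
    also have "\<dots> = (\<integral>\<^sup>+z. \<integral>\<^sup>+x. \<integral>\<^sup>+y. f (z(i := x, j := y)) \<partial>lborel \<partial>lborel \<partial>lborel_PiM J)"
    proof (rule nn_integral_cong)
      fix z :: "'i \<Rightarrow> 'a" assume z: "z \<in> space (lborel_PiM J)"
      show "(\<integral>\<^sup>+y. \<integral>\<^sup>+x. f (z(i := x, j := y)) \<partial>lborel \<partial>lborel) = (\<integral>\<^sup>+x. \<integral>\<^sup>+y. f (z(i := x, j := y)) \<partial>lborel \<partial>lborel)"
        using measurable_compose[OF upd[OF z] f]
        by (intro lborel_pair.Fubini'[where f="\<lambda>x y. f (z(i := x, j := y))"]) (simp add: case_prod_beta')
    qed
    finally show ?thesis .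
  qed
  fix A assume "A \<in> sets (distr ?M ?M ?T)"
  then have A[measurable]: "A \<in> sets ?M" by simp
  have "emeasure (distr ?M ?M ?T) A = (\<integral>\<^sup>+x. indicator A (?T x) \<partial>?M)"
    by (simp add: nn_integral_indicator[symmetric] nn_integral_distr del: nn_integral_indicator)
  also have "\<dots> = (\<integral>\<^sup>+z. \<integral>\<^sup>+x. \<integral>\<^sup>+y. indicator A (?T (z(i := x, j := y))) \<partial>lborel \<partial>lborel \<partial>lborel_PiM J)"
    by (rule split) measurable
  also have "\<dots> = (\<integral>\<^sup>+z. \<integral>\<^sup>+x. \<integral>\<^sup>+y. indicator A (z(i := x, j := y)) \<partial>lborel \<partial>lborel \<partial>lborel_PiM J)"
  proof (rule nn_integral_cong)
    fix z :: "'i \<Rightarrow> 'a" assume z: "z \<in> space (lborel_PiM J)"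
    have "(\<lambda>p. indicator A (z(i := fst p, j := snd p)) :: ennreal) \<in> borel_measurable (lborel \<Otimes>\<^sub>M lborel)"
      using measurable_compose[OF upd[OF z] borel_measurable_indicator[OF A]] .
    from nn_integral_lborel_plane_refl[OF this assms(5)]
    show "(\<integral>\<^sup>+x. \<integral>\<^sup>+y. indicator A (?T (z(i := x, j := y))) \<partial>lborel \<partial>lborel)
       = (\<integral>\<^sup>+x. \<integral>\<^sup>+y. indicator A (z(i := x, j := y)) \<partial>lborel \<partial>lborel)"
      using assms(4) by (simp add: plane_refl_def fun_upd_twist)
  qed
  also have "\<dots> = (\<integral>\<^sup>+x. indicator A x \<partial>?M)"
    by (rule split[symmetric]) measurable
  finally show "emeasure (distr ?M ?M ?T) A = emeasure ?M A" by simp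
qed simp

section \<open>Uniform measures on spheres\<close>

lemma sum_norm_plane_refl:
  fixes x :: "'i \<Rightarrow> 'a::real_inner"
  assumes "finite I" "i \<in> I" "j \<in> I" "i \<noteq> j" "c\<^sup>2 + s\<^sup>2 = 1"
  shows "(\<Sum>k\<in>I. (norm (plane_refl i j c s x k))\<^sup>2) = (\<Sum>k\<in>I. (norm (x k))\<^sup>2)"
proof -
  have "(norm (c *\<^sub>R u + s *\<^sub>R v))\<^sup>2 + (norm (s *\<^sub>R u - c *\<^sub>R v))\<^sup>2 = (c\<^sup>2 + s\<^sup>2) * ((norm u)\<^sup>2 + (norm v)\<^sup>2)" for u v :: 'a
    unfolding power2_norm_eq_inner power2_eq_square[of c] power2_eq_square[of s]
    by (simp only: inner_simps inner_commute[of v u]) (simp add: algebra_simps)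
  moreover have "I = insert i (insert j (I - {i, j}))" using assms by auto
  then have "(\<Sum>k\<in>I. f k) = f i + f j + (\<Sum>k\<in>I - {i, j}. f k)" for f :: "'i \<Rightarrow> real"
    using assms sum.remove[of I i f] sum.remove[of "I - {i}" j f] by (auto simp: Diff_insert2[symmetric] insert_commute)
  ultimately show ?thesis
    using assms by (simp add: plane_refl_def)
qed

definition normalize_vec :: "nat \<Rightarrow> (nat \<Rightarrow> 'a::real_normed_vector) \<Rightarrow> nat \<Rightarrow> 'a" where
  "normalize_vec d x = restrict (\<lambda>i. x i /\<^sub>R sqrt (\<Sum>j<d. (norm (x j))\<^sup>2)) {..<d}"

definition unit_ball_PiM :: "nat \<Rightarrow> (nat \<Rightarrow> 'a::euclidean_space) set" where
  "unit_ball_PiM d = {x \<in> space (lborel_PiM {..<d}). (\<Sum>i<d. (norm (x i))\<^sup>2) < 1}"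

text \<open>Generic in the scalar type, so that normalisation and invariance are proved once for the
  real and the complex sphere.\<close>

definition unif_sphere :: "nat \<Rightarrow> (nat \<Rightarrow> 'a::euclidean_space) measure" where
  "unif_sphere d = distr (uniform_measure (lborel_PiM {..<d}) (unit_ball_PiM d)) (lborel_PiM {..<d}) (normalize_vec d)"

lemma unif_sphere_real_eq: "unif_sphere_real d = unif_sphere d"
  unfolding unif_sphere_real_def unif_sphere_def real_space_def unit_ball_PiM_def normalize_vec_def
  by (simp add: divide_inverse mult.commute)

lemma unif_sphere_cplx_eq: "unif_sphere_cplx d = unif_sphere d"
  unfolding unif_sphere_cplx_def unif_sphere_def cplx_space_def unit_ball_PiM_def normalize_vec_def
  by (simp add: divide_inverse mult.commute scaleR_conv_of_real)

lemma unit_ball_PiM_sets: "(unit_ball_PiM d :: (nat \<Rightarrow> 'a::euclidean_space) set) \<in> sets (lborel_PiM {..<d})"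
proof -
  have [measurable]: "(\<lambda>x. x k) \<in> borel_measurable (lborel_PiM {..<d} :: (nat \<Rightarrow> 'a) measure)" if "k \<in> {..<d}" for k
    using that by (rule lborel_PiM_component_measurable)
  show ?thesis unfolding unit_ball_PiM_def by measurable
qed

lemma normalize_vec_measurable:
  "normalize_vec d \<in> measurable (lborel_PiM {..<d} :: (nat \<Rightarrow> 'a::euclidean_space) measure) (lborel_PiM {..<d})"
proof -
  have [measurable]: "(\<lambda>x. x k) \<in> borel_measurable (lborel_PiM {..<d} :: (nat \<Rightarrow> 'a) measure)" if "k \<in> {..<d}" for k
    using that by (rule lborel_PiM_component_measurable)
  show ?thesis unfolding normalize_vec_def by (rule measurable_restrict) measurable
qed

text \<open>The ball is squeezed between products of coordinate balls of radius
  \<open>1 / sqrt d\<close> and of radius 1, whose measures are explicit. Together the two facts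
  make the uniform measure on the ball a probability measure.\<close>

lemma emeasure_unit_ball_PiM:
  assumes "d > 0"
  shows "emeasure (lborel_PiM {..<d}) (unit_ball_PiM d :: (nat \<Rightarrow> 'a::euclidean_space) set) \<noteq> 0"
    and "emeasure (lborel_PiM {..<d}) (unit_ball_PiM d :: (nat \<Rightarrow> 'a::euclidean_space) set) \<noteq> \<infinity>"
proof -
  interpret product_sigma_finite "\<lambda>_::nat. lborel :: 'a measure" ..
  let ?P = "\<lambda>r. PiE {..<d} (\<lambda>_. ball (0::'a) r)" and ?B = "unit_ball_PiM d :: (nat \<Rightarrow> 'a) set"
  let ?M = "lborel_PiM {..<d} :: (nat \<Rightarrow> 'a) measure"
  have em: "emeasure ?M (?P r) = (\<Prod>i<d. emeasure lborel (ball (0::'a) r))" for r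
    by (rule emeasure_PiM) auto
  have sets: "?P r \<in> sets ?M" for r
    by (rule sets_PiM_I_finite) auto
  have sub1: "?P (1 / sqrt d) \<subseteq> ?B"
  proof
    fix x assume x: "x \<in> ?P (1 / sqrt d)"
    have "(\<Sum>i<d. (norm (x i))\<^sup>2) < (\<Sum>i<d. 1 / real d)"
    proof (rule sum_strict_mono)
      fix i assume "i \<in> {..<d}"
      then have "norm (x i) < 1 / sqrt d" using x by (auto simp: PiE_iff)
      then have "(norm (x i))\<^sup>2 < (1 / sqrt d)\<^sup>2" by (intro power_strict_mono) auto
      then show "(norm (x i))\<^sup>2 < 1 / real d" by (simp add: power_divide)
    qed (use assms in auto)
    then show "x \<in> ?B"
      using x assms by (auto simp: unit_ball_PiM_def space_PiM PiE_iff)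
  qed
  have sub2: "?B \<subseteq> ?P 1"
  proof
    fix x assume x: "x \<in> ?B"
    have "norm (x i) < 1" if "i < d" for i
    proof -
      have "(norm (x i))\<^sup>2 \<le> (\<Sum>i<d. (norm (x i))\<^sup>2)"
        using that by (intro member_le_sum) auto
      also have "\<dots> < 1" using x by (simp add: unit_ball_PiM_def)
      finally show ?thesis by (simp add: power2_less_1_iff abs_square_less_1)
    qed
    then show "x \<in> ?P 1" using x by (auto simp: unit_ball_PiM_def space_PiM PiE_iff)
  qed
  have "emeasure lborel (ball (0::'a) r) \<noteq> 0" if "r > 0" for r
    using content_ball_pos[OF that, of "0::'a"] by (auto simp: measure_def)
  then have "emeasure ?M (?P (1 / sqrt d)) \<noteq> 0"
    using assms unfolding em by simp
  then show "emeasure ?M ?B \<noteq> 0"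
    using emeasure_mono[OF sub1 unit_ball_PiM_sets] by auto
  have "emeasure ?M (?P 1) < \<infinity>"
    unfolding em using emeasure_lborel_ball_finite[of "0::'a" 1] by (simp add: power_less_top_ennreal)
  then show "emeasure ?M ?B \<noteq> \<infinity>"
    using emeasure_mono[OF sub2 sets] by (auto simp: top_unique)
qed

lemma prob_space_unif_sphere:
  assumes "d > 0"
  shows "prob_space (unif_sphere d :: (nat \<Rightarrow> 'a::euclidean_space) measure)"
  unfolding unif_sphere_def
  using normalize_vec_measurable prob_space_uniform_measure[OF emeasure_unit_ball_PiM[OF assms, where 'a='a]]
  by (intro prob_space.prob_space_distr) (auto simp: measurable_cong_sets[OF sets_uniform_measure])

lemma sets_unif_sphere [simp]: "sets (unif_sphere d) = sets (lborel_PiM {..<d})"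
  by (simp add: unif_sphere_def)

lemma space_unif_sphere [simp]: "space (unif_sphere d) = space (lborel_PiM {..<d})"
  by (simp add: unif_sphere_def)

text \<open>Normalisation fails only at the origin, where division by zero returns the zero vector;
  for \<open>d > 0\<close> this is a null set.\<close>

lemma AE_unif_sphere_norm:
  assumes "d > 0"
  shows "AE x in (unif_sphere d :: (nat \<Rightarrow> 'a::euclidean_space) measure). (\<Sum>i<d. (norm (x i))\<^sup>2) = 1"
proof -
  interpret product_sigma_finite "\<lambda>_::nat. lborel :: 'a measure" ..
  let ?M = "lborel_PiM {..<d} :: (nat \<Rightarrow> 'a) measure"
  have [measurable]: "(\<lambda>x. x k) \<in> borel_measurable ?M" if "k \<in> {..<d}" for k
    using that by (rule lborel_PiM_component_measurable)
  have "emeasure ?M (PiE {..<d} (\<lambda>_. {0})) = (\<Prod>i<d. emeasure lborel {0::'a})"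
    by (rule emeasure_PiM) auto
  moreover have "PiE {..<d} (\<lambda>_. {0}) \<in> sets ?M"
    by (rule sets_PiM_I_finite) auto
  ultimately have "PiE {..<d} (\<lambda>_. {0}) \<in> null_sets ?M"
    using assms by (simp add: null_sets_def)
  then have "AE x in ?M. x \<notin> PiE {..<d} (\<lambda>_. {0})"
    by (rule AE_not_in)
  then have "AE x in ?M. (\<Sum>i<d. (norm (normalize_vec d x i))\<^sup>2) = 1"
    using AE_space
  proof eventually_elim
    case (elim x)
    then obtain k where "k < d" "x k \<noteq> 0"
      by (auto simp: space_PiM PiE_iff extensional_def fun_eq_iff split: if_splits)
    then have pos: "(\<Sum>j<d. (norm (x j))\<^sup>2) > 0"
      by (intro sum_pos2[of _ k]) auto
    have "(\<Sum>i<d. (norm (normalize_vec d x i))\<^sup>2) = (\<Sum>i<d. (norm (x i))\<^sup>2 / (\<Sum>j<d. (norm (x j))\<^sup>2))"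
      using pos by (intro sum.cong) (auto simp: normalize_vec_def power_mult_distrib power_inverse divide_inverse mult.commute)
    also have "\<dots> = 1" using pos by (simp add: sum_divide_distrib[symmetric])
    finally show ?case .
  qed
  then have "AE x in uniform_measure ?M (unit_ball_PiM d). (\<Sum>i<d. (norm (normalize_vec d x i))\<^sup>2) = 1"
    by (intro AE_uniform_measureI unit_ball_PiM_sets) auto
  then show ?thesis
    unfolding unif_sphere_def
    using normalize_vec_measurable
    by (subst AE_distr_iff) (auto simp: measurable_cong_sets[OF sets_uniform_measure])
qed

lemma distr_uniform_measure_invariant:
  assumes T: "T \<in> measurable M M" and inv: "distr M M T = M"
    and A: "A \<in> sets M" "\<And>x. x \<in> space M \<Longrightarrow> T x \<in> A \<longleftrightarrow> x \<in> A"
  shows "distr (uniform_measure M A) M T = uniform_measure M A"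
proof (rule measure_eqI)
  fix B assume "B \<in> sets (distr (uniform_measure M A) M T)"
  then have B: "B \<in> sets M" by simp
  have TB: "T -` B \<inter> space M \<in> sets M" using T B by (rule measurable_sets)
  have eq: "A \<inter> (T -` B \<inter> space M) = T -` (A \<inter> B) \<inter> space M"
    using A sets.sets_into_space[OF A(1)] by auto
  have "emeasure (distr (uniform_measure M A) M T) B = emeasure (uniform_measure M A) (T -` B \<inter> space M)"
    using T B by (subst emeasure_distr) (auto simp: measurable_cong_sets[OF sets_uniform_measure])
  also have "\<dots> = emeasure M (T -` (A \<inter> B) \<inter> space M) / emeasure M A"
    using A TB by (simp add: eq)
  also have "emeasure M (T -` (A \<inter> B) \<inter> space M) = emeasure (distr M M T) (A \<inter> B)"
    using A B T by (subst emeasure_distr) auto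
  finally show "emeasure (distr (uniform_measure M A) M T) B = emeasure (uniform_measure M A) B"
    using A B by (simp add: inv)
qed simp

text \<open>A norm-preserving linear map commutes with normalisation and leaves the unit ball
  invariant, so the claim reduces to the invariance of Lebesgue measure.\<close>

lemma distr_unif_sphere_plane_refl:
  assumes ij: "i < d" "j < d" "i \<noteq> j" "c\<^sup>2 + s\<^sup>2 = 1"
  shows "distr (unif_sphere d) (lborel_PiM {..<d}) (plane_refl i j c s) = (unif_sphere d :: (nat \<Rightarrow> 'a::euclidean_space) measure)"
proof -
  let ?M = "lborel_PiM {..<d} :: (nat \<Rightarrow> 'a) measure" and ?T = "plane_refl i j c s :: _ \<Rightarrow> nat \<Rightarrow> 'a"
  let ?U = "uniform_measure ?M (unit_ball_PiM d)"
  have T: "?T \<in> measurable ?M ?M" using ij by (intro plane_refl_measurable) auto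
  have N: "normalize_vec d \<in> measurable ?M ?M" by (rule normalize_vec_measurable)
  have norm: "(\<Sum>k<d. (norm (?T x k))\<^sup>2) = (\<Sum>k<d. (norm (x k))\<^sup>2)" for x
    using ij by (intro sum_norm_plane_refl) auto
  have comm: "?T (normalize_vec d x) = normalize_vec d (?T x)" for x
    unfolding normalize_vec_def norm using ij
    by (auto simp: plane_refl_def fun_eq_iff algebra_simps restrict_def)
  have mU: "measurable ?U K = measurable ?M K" for K :: "(nat \<Rightarrow> 'a) measure"
    by (rule measurable_cong_sets) auto
  have "distr (unif_sphere d) ?M ?T = distr ?U ?M (\<lambda>x. ?T (normalize_vec d x))"
    unfolding unif_sphere_def using T N by (subst distr_distr) (auto simp: comp_def mU)
  also have "\<dots> = distr (distr ?U ?M ?T) ?M (normalize_vec d)"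
    using T N by (subst distr_distr) (auto simp: comp_def mU comm)
  also have "distr ?U ?M ?T = ?U"
  proof (rule distr_uniform_measure_invariant[OF T _ unit_ball_PiM_sets])
    show "distr ?M ?M ?T = ?M" using ij by (intro distr_lborel_PiM_plane_refl) auto
    show "?T x \<in> unit_ball_PiM d \<longleftrightarrow> x \<in> unit_ball_PiM d" if "x \<in> space ?M" for x
      using measurable_space[OF T that] that by (simp add: unit_ball_PiM_def norm)
  qed
  finally show ?thesis unfolding unif_sphere_def .
qed

section \<open>Reflection-invariant random arrays\<close>

text \<open>An amplitude depends only on the multiset of pairs (input, coordinate). Hence sign flips
  act through multiplicities, and tuples that differ by permuting copies of the same input have
  equal amplitudes.\<close>

lemma copies_state_eq_prod_mset:
  "length js = length s \<Longrightarrow> copies_state s X js = (\<Prod>p\<in>#mset (zip s js). case_prod X p)"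
proof -
  assume len: "length js = length s"
  have "copies_state s X js = (\<Prod>t\<leftarrow>[0..<length s]. X (s ! t) (js ! t))"
    unfolding copies_state_def by (simp add: prod.list_conv_set_nth atLeast0LessThan)
  also have "map (\<lambda>t. X (s ! t) (js ! t)) [0..<length s] = map (case_prod X) (zip s js)"
    using len by (intro nth_equalityI) auto
  finally show ?thesis by (simp add: prod_mset_prod_list[symmetric])
qed

lemma prod_mset_flip:
  fixes f :: "'b \<Rightarrow> 'a::comm_ring_1"
  shows "(\<Prod>p\<in>#A. if p = q then - f p else f p) = (-1) ^ count A q * (\<Prod>p\<in>#A. f p)"
  by (induction A) (auto simp: algebra_simps)

lemma finite_basis_idx [simp]: "finite (basis_idx M d)"
  using finite_lists_length_eq[of "{..<d}" M] by (simp add: basis_idx_def conj_commute)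

lemma basis_idx_nth: "js \<in> basis_idx M d \<Longrightarrow> t < M \<Longrightarrow> js ! t < d"
  using nth_mem by (fastforce simp: basis_idx_def)

lemma sum_basis_idx_prod:
  fixes f :: "nat \<Rightarrow> nat \<Rightarrow> 'a::comm_semiring_1"
  shows "(\<Sum>js\<in>basis_idx M d. \<Prod>t<M. f t (js ! t)) = (\<Prod>t<M. \<Sum>j<d. f t j)"
proof -
  have "(\<Prod>t<M. \<Sum>j<d. f t j) = (\<Sum>g\<in>PiE {..<M} (\<lambda>_. {..<d}). \<Prod>t<M. f t (g t))"
    by (rule prod_sum_PiE) auto
  also have "\<dots> = (\<Sum>js\<in>basis_idx M d. \<Prod>t<M. f t (js ! t))"
    by (rule sum.reindex_bij_witness[where i="\<lambda>js. restrict ((!) js) {..<M}" and j="\<lambda>g. map g [0..<M]"])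
      (auto simp: basis_idx_def fun_eq_iff PiE_iff extensional_def list_eq_iff_nth_eq subset_iff)
  finally show ?thesis ..
qed

definition row_refl :: "'k \<Rightarrow> 'i \<Rightarrow> 'i \<Rightarrow> real \<Rightarrow> real \<Rightarrow> ('k \<Rightarrow> 'i \<Rightarrow> 'a::real_vector) \<Rightarrow> 'k \<Rightarrow> 'i \<Rightarrow> 'a" where
  "row_refl i j j' c s X = X(i := plane_refl j j' c s (X i))"

text \<open>Stated through pairs, so that a coordinate may recur at positions that hold copies of
  different inputs.\<close>

definition collision_free :: "nat list \<Rightarrow> nat \<Rightarrow> nat list set" where
  "collision_free s d = {a \<in> basis_idx (length s) d. distinct (zip s a)}"

definition quad_form :: "nat list set \<Rightarrow> (nat list \<Rightarrow> nat list \<Rightarrow> complex) \<Rightarrow> (nat list \<Rightarrow> complex) \<Rightarrow> real" where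
  "quad_form I F v = Re (\<Sum>a\<in>I. \<Sum>b\<in>I. cnj (v a) * F a b * v b)"

text \<open>Up to a scalar, the pairing of \<open>F\<close> with the collision-free block of the averaged input state; only the scalar
  depends on the special index.\<close>
definition class_sum :: "nat list \<Rightarrow> nat \<Rightarrow> (nat list \<Rightarrow> nat list \<Rightarrow> complex) \<Rightarrow> real" where
  "class_sum s d F = Re (\<Sum>a\<in>collision_free s d. \<Sum>b\<in>collision_free s d. if mset (zip s a) = mset (zip s b) then F a b else 0)"

text \<open>Isolates what the argument uses of the input distribution, in a form that does not
  mention which row is the real one. Even a sign flip is a reflection naming two coordinates, whence
  \<open>2 \<le> d\<close>.\<close>

locale refl_invariant_array = prob_space \<mu>
  for \<mu> :: "(nat \<Rightarrow> nat \<Rightarrow> complex) measure" and K :: "nat set" and d :: nat +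
  assumes entry_measurable: "i \<in> K \<Longrightarrow> j < d \<Longrightarrow> (\<lambda>X. X i j) \<in> borel_measurable \<mu>"
    and AE_row_norm: "i \<in> K \<Longrightarrow> AE X in \<mu>. (\<Sum>j<d. (cmod (X i j))\<^sup>2) = 1"
    and row_refl_measurable: "i \<in> K \<Longrightarrow> j < d \<Longrightarrow> j' < d \<Longrightarrow> j \<noteq> j' \<Longrightarrow> c\<^sup>2 + s\<^sup>2 = 1 \<Longrightarrow>
      row_refl i j j' c s \<in> measurable \<mu> \<mu>"
    and distr_row_refl: "i \<in> K \<Longrightarrow> j < d \<Longrightarrow> j' < d \<Longrightarrow> j \<noteq> j' \<Longrightarrow> c\<^sup>2 + s\<^sup>2 = 1 \<Longrightarrow>
      distr \<mu> \<mu> (row_refl i j j' c s) = \<mu>"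
    and dim_ge_2: "2 \<le> d"
begin

section \<open>Fourth moments of the coordinates of a row\<close>

lemma integral_row_refl:
  fixes f :: "_ \<Rightarrow> 'b::{banach, second_countable_topology}"
  assumes "i \<in> K" "j < d" "j' < d" "j \<noteq> j'" "c\<^sup>2 + s\<^sup>2 = 1" "f \<in> borel_measurable \<mu>"
  shows "(\<integral>X. f (row_refl i j j' c s X) \<partial>\<mu>) = (\<integral>X. f X \<partial>\<mu>)"
  using integral_distr[OF row_refl_measurable[OF assms(1-5)] assms(6)]
  unfolding distr_row_refl[OF assms(1-5)] by (rule sym)

lemma AE_rows: "AE X in \<mu>. \<forall>i\<in>K. (\<Sum>j<d. (cmod (X i j))\<^sup>2) = 1"
  using AE_row_norm by (subst AE_ball_countable) auto

lemma cmod_le_1_of_unit: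
  assumes "(\<Sum>j<d. (cmod (x j))\<^sup>2) = 1" "j < d"
  shows "cmod (x j) \<le> 1"
proof -
  have "(cmod (x j))\<^sup>2 \<le> (\<Sum>j<d. (cmod (x j))\<^sup>2)"
    using assms(2) by (intro member_le_sum) auto
  then show ?thesis using assms(1) by (simp add: abs_square_le_1)
qed

definition sq_corr :: "nat \<Rightarrow> nat \<Rightarrow> nat \<Rightarrow> real" where
  "sq_corr i j j' = (\<integral>X. (cmod (X i j))\<^sup>2 * (cmod (X i j'))\<^sup>2 \<partial>\<mu>)"

lemma sq_corr_integrable:
  assumes "i \<in> K" "j < d" "j' < d"
  shows "integrable \<mu> (\<lambda>X. (cmod (X i j))\<^sup>2 * (cmod (X i j'))\<^sup>2)"
proof (rule integrable_const_bound)
  note [measurable] = entry_measurable[OF assms(1,2)] entry_measurable[OF assms(1,3)]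
  show "(\<lambda>X. (cmod (X i j))\<^sup>2 * (cmod (X i j'))\<^sup>2) \<in> borel_measurable \<mu>" by measurable
  show "AE X in \<mu>. norm ((cmod (X i j))\<^sup>2 * (cmod (X i j'))\<^sup>2) \<le> 1"
    using AE_row_norm[OF assms(1)]
  proof eventually_elim
    case (elim X)
    then show ?case
      using cmod_le_1_of_unit[where x="X i", OF elim] assms by (auto simp: norm_mult intro!: mult_le_one power_le_one)
  qed
qed

lemma has_bochner_integral_sq_corr:
  "i \<in> K \<Longrightarrow> j < d \<Longrightarrow> j' < d \<Longrightarrow>
    has_bochner_integral \<mu> (\<lambda>X. (cmod (X i j))\<^sup>2 * (cmod (X i j'))\<^sup>2) (sq_corr i j j')"
  unfolding sq_corr_def by (intro has_bochner_integral_integrable sq_corr_integrable)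

text \<open>A Hadamard mixing of coordinates \<open>j, j'\<close> turns \<open>|u|\<^sup>2 |v|\<^sup>2\<close> into \<open>|u\<^sup>2 - v\<^sup>2|\<^sup>2 / 4\<close>, which is at least
  \<open>(|u|\<^sup>2 - |v|\<^sup>2)\<^sup>2 / 4\<close>. This argument covers real and complex spheres at once.\<close>
lemma sq_corr_ge:
  assumes "i \<in> K" "j < d" "j' < d"
  shows "sq_corr i j j + sq_corr i j' j' \<le> 6 * sq_corr i j j'"
proof (cases "j = j'")
  case True
  have "0 \<le> sq_corr i j' j'" unfolding sq_corr_def by (rule integral_nonneg_AE) auto
  then show ?thesis using True by simp
next
  case False
  note [measurable] = entry_measurable[OF assms(1,2)] entry_measurable[OF assms(1,3)]
  note int = sq_corr_integrable[OF assms(1)]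
  define h where "h = 1 / sqrt 2"
  have h: "h\<^sup>2 + h\<^sup>2 = 1" by (simp add: h_def power_divide)
  define f where "f X = (cmod (X i j))\<^sup>2 * (cmod (X i j'))\<^sup>2" for X :: "nat \<Rightarrow> nat \<Rightarrow> complex"
  have f[measurable]: "f \<in> borel_measurable \<mu>" unfolding f_def by measurable
  have intf: "integrable \<mu> f" unfolding f_def using int assms by simp
  have fT: "((cmod (X i j))\<^sup>2 * (cmod (X i j))\<^sup>2 + (cmod (X i j'))\<^sup>2 * (cmod (X i j'))\<^sup>2 - 2 * f X) / 4
       \<le> f (row_refl i j j' h h X)" for X
  proof -
    define u v where "u = X i j" and "v = X i j'"
    have "f (row_refl i j j' h h X) = (cmod (h *\<^sub>R u + h *\<^sub>R v))\<^sup>2 * (cmod (h *\<^sub>R u - h *\<^sub>R v))\<^sup>2"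
      using False by (simp add: f_def row_refl_def plane_refl_def u_def v_def)
    also have "\<dots> = (cmod ((h *\<^sub>R u + h *\<^sub>R v) * (h *\<^sub>R u - h *\<^sub>R v)))\<^sup>2"
      by (simp add: norm_mult power_mult_distrib)
    also have "(h *\<^sub>R u + h *\<^sub>R v) * (h *\<^sub>R u - h *\<^sub>R v) = (h\<^sup>2) *\<^sub>R (u\<^sup>2 - v\<^sup>2)"
      by (simp add: algebra_simps power2_eq_square)
    also have "h\<^sup>2 = 1/2" using h by simp
    also have "(cmod ((1/2) *\<^sub>R (u\<^sup>2 - v\<^sup>2)))\<^sup>2 = (cmod (u\<^sup>2 - v\<^sup>2))\<^sup>2 / 4"
      by (simp add: power_divide)
    finally have eq: "f (row_refl i j j' h h X) = (cmod (u\<^sup>2 - v\<^sup>2))\<^sup>2 / 4" .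
    have "\<bar>cmod (u\<^sup>2) - cmod (v\<^sup>2)\<bar>\<^sup>2 \<le> (cmod (u\<^sup>2 - v\<^sup>2))\<^sup>2"
      by (intro power_mono norm_triangle_ineq3) auto
    then have "((cmod u)\<^sup>2 - (cmod v)\<^sup>2)\<^sup>2 \<le> (cmod (u\<^sup>2 - v\<^sup>2))\<^sup>2"
      by (simp add: norm_power)
    then show ?thesis
      unfolding eq by (simp add: f_def u_def v_def power2_diff power2_eq_square algebra_simps)
  qed
  have hb: "has_bochner_integral \<mu> (\<lambda>X. ((cmod (X i j))\<^sup>2 * (cmod (X i j))\<^sup>2 + (cmod (X i j'))\<^sup>2 * (cmod (X i j'))\<^sup>2 - 2 * f X) / 4)
      ((sq_corr i j j + sq_corr i j' j' - 2 * sq_corr i j j') / 4)"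
    unfolding f_def using assms
    by (intro has_bochner_integral_divide has_bochner_integral_diff has_bochner_integral_add
        has_bochner_integral_mult_right has_bochner_integral_sq_corr) auto
  then have "(sq_corr i j j + sq_corr i j' j' - 2 * sq_corr i j j') / 4 =
     (\<integral>X. ((cmod (X i j))\<^sup>2 * (cmod (X i j))\<^sup>2 + (cmod (X i j'))\<^sup>2 * (cmod (X i j'))\<^sup>2 - 2 * f X) / 4 \<partial>\<mu>)"
    by (simp only: has_bochner_integral_iff)
  \<comment> \<open>By invariance the right side is \<open>sq_corr i j j'\<close> again. Clearing
    the denominator 4 and moving the subtracted \<open>2 * sq_corr i j j'\<close> across gives the
    factor 6 = 4 + 2.\<close>
  also have "\<dots> \<le> (\<integral>X. f (row_refl i j j' h h X) \<partial>\<mu>)"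
  proof (rule integral_mono[OF _ _ fT])
    show "integrable \<mu> (\<lambda>X. ((cmod (X i j))\<^sup>2 * (cmod (X i j))\<^sup>2 + (cmod (X i j'))\<^sup>2 * (cmod (X i j'))\<^sup>2 - 2 * f X) / 4)"
      using hb by (simp only: has_bochner_integral_iff)
    show "integrable \<mu> (\<lambda>X. f (row_refl i j j' h h X))"
      using intf integrable_distr_eq[OF row_refl_measurable f, of i j j' h h] distr_row_refl[of i j j' h h] assms False h
      by simp
  qed
  also have "\<dots> = sq_corr i j j'"
    unfolding integral_row_refl[OF assms False h f] by (simp only: sq_corr_def f_def[abs_def])
  finally show ?thesis by simp
qed

text \<open>Summing \<open>sq_corr_ge\<close> over all ordered pairs, diagonal included, puts
  \<open>2 * d\<close> times the left side against 6 times the sum of all correlations. That sum is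
  the mean fourth power of the norm of the row, which is 1.\<close>

lemma sum_fourth_moments_le:
  assumes "i \<in> K"
  shows "(\<Sum>j<d. sq_corr i j j) \<le> 3 / d"
proof -
  have hb: "has_bochner_integral \<mu> (\<lambda>X. \<Sum>j<d. \<Sum>j'<d. (cmod (X i j))\<^sup>2 * (cmod (X i j'))\<^sup>2)
      (\<Sum>j<d. \<Sum>j'<d. sq_corr i j j')"
    by (intro has_bochner_integral_sum has_bochner_integral_sq_corr assms) auto
  then have "(\<Sum>j<d. \<Sum>j'<d. sq_corr i j j') = (\<integral>X. (\<Sum>j<d. \<Sum>j'<d. (cmod (X i j))\<^sup>2 * (cmod (X i j'))\<^sup>2) \<partial>\<mu>)"
    by (rule has_bochner_integral_integral_eq[symmetric])
  also have "\<dots> = (\<integral>X. 1 \<partial>\<mu>)"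
  proof (rule integral_cong_AE)
    show "(\<lambda>X. \<Sum>j<d. \<Sum>j'<d. (cmod (X i j))\<^sup>2 * (cmod (X i j'))\<^sup>2) \<in> borel_measurable \<mu>"
      using hb by (rule borel_measurable_has_bochner_integral)
    show "AE X in \<mu>. (\<Sum>j<d. \<Sum>j'<d. (cmod (X i j))\<^sup>2 * (cmod (X i j'))\<^sup>2) = 1"
      using AE_row_norm[OF assms] by eventually_elim (simp add: sum_product[symmetric])
  qed simp
  finally have one: "(\<Sum>j<d. \<Sum>j'<d. sq_corr i j j') = 1" by (simp add: prob_space)
  have "(\<Sum>j<d. \<Sum>j'<d. sq_corr i j j + sq_corr i j' j') \<le> (\<Sum>j<d. \<Sum>j'<d. 6 * sq_corr i j j')"
    using sq_corr_ge[OF assms] by (intro sum_mono) auto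
  then have "2 * d * (\<Sum>j<d. sq_corr i j j) \<le> 6"
    using one by (simp add: sum.distrib sum_distrib_left[symmetric])
  then show ?thesis using dim_ge_2 by (simp add: field_simps)
qed

section \<open>The averaged density matrix and its symmetries\<close>

lemma copies_state_measurable:
  assumes "set s \<subseteq> K" "a \<in> basis_idx (length s) d"
  shows "(\<lambda>X. copies_state s X a) \<in> borel_measurable \<mu>"
  unfolding copies_state_def
  using assms basis_idx_nth[OF assms(2)]
  by (intro borel_measurable_prod entry_measurable) (auto simp: subset_iff)

lemma AE_copies_state_le_1:
  assumes "set s \<subseteq> K"
  shows "AE X in \<mu>. \<forall>a\<in>basis_idx (length s) d. cmod (copies_state s X a) \<le> 1"
  using AE_rows
proof eventually_elim
  case (elim X)
  show ?case
  proof
    fix a assume a: "a \<in> basis_idx (length s) d"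
    show "cmod (copies_state s X a) \<le> 1"
      unfolding copies_state_def prod_norm[symmetric]
    proof (rule prod_le_1)
      fix t assume "t \<in> {..<length s}"
      then have "s ! t \<in> K" "a ! t < d" using assms basis_idx_nth[OF a] by auto
      then show "0 \<le> cmod (X (s ! t) (a ! t)) \<and> cmod (X (s ! t) (a ! t)) \<le> 1"
        using elim cmod_le_1_of_unit[of "X (s ! t)" "a ! t"] by simp
    qed
  qed
qed

text \<open>Entry \<open>(b, a)\<close> of the averaged density matrix. With this order of indices
  the mean of the quadratic form of \<open>F\<close> is the plain sum of
  \<open>F a b * rho s a b\<close>.\<close>

definition rho :: "nat list \<Rightarrow> nat list \<Rightarrow> nat list \<Rightarrow> complex" where
  "rho s a b = (\<integral>X. cnj (copies_state s X a) * copies_state s X b \<partial>\<mu>)"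

lemma rho_integrable:
  assumes "set s \<subseteq> K" "a \<in> basis_idx (length s) d" "b \<in> basis_idx (length s) d"
  shows "integrable \<mu> (\<lambda>X. cnj (copies_state s X a) * copies_state s X b)"
proof (rule integrable_const_bound)
  have "cnj \<in> borel_measurable borel"
    by (intro borel_measurable_continuous_onI continuous_intros)
  then show "(\<lambda>X. cnj (copies_state s X a) * copies_state s X b) \<in> borel_measurable \<mu>"
    using copies_state_measurable[OF assms(1,2)] copies_state_measurable[OF assms(1,3)]
    by (intro borel_measurable_times) (auto intro: measurable_compose)
  show "AE X in \<mu>. norm (cnj (copies_state s X a) * copies_state s X b) \<le> 1"
    using AE_copies_state_le_1[OF assms(1)]
    by eventually_elim (use assms in \<open>auto simp: norm_mult intro!: mult_le_one\<close>)
qed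

lemma integral_quad_form:
  assumes "set s \<subseteq> K" "J \<subseteq> basis_idx (length s) d"
  shows "integrable \<mu> (\<lambda>X. quad_form J F (copies_state s X))"
    and "(\<integral>X. quad_form J F (copies_state s X) \<partial>\<mu>) = Re (\<Sum>a\<in>J. \<Sum>b\<in>J. F a b * rho s a b)"
proof -
  have eq: "quad_form J F (copies_state s X) = Re (\<Sum>a\<in>J. \<Sum>b\<in>J. F a b * (cnj (copies_state s X a) * copies_state s X b))" for X
    by (simp add: quad_form_def mult_ac)
  have "has_bochner_integral \<mu> (\<lambda>X. \<Sum>a\<in>J. \<Sum>b\<in>J. F a b * (cnj (copies_state s X a) * copies_state s X b))
     (\<Sum>a\<in>J. \<Sum>b\<in>J. F a b * rho s a b)"
    unfolding rho_def using assms
    by (intro has_bochner_integral_sum has_bochner_integral_mult_right has_bochner_integral_integrable rho_integrable) auto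
  from has_bochner_integral_Re[OF this]
  show "integrable \<mu> (\<lambda>X. quad_form J F (copies_state s X))"
    and "(\<integral>X. quad_form J F (copies_state s X) \<partial>\<mu>) = Re (\<Sum>a\<in>J. \<Sum>b\<in>J. F a b * rho s a b)"
    unfolding eq by (auto simp: has_bochner_integral_iff)
qed

text \<open>Flipping the sign of the array entry \<open>p\<close> preserves the distribution but
  negates the integrand, in which that entry occurs an odd number of times.\<close>

lemma rho_odd_eq_0:
  assumes s: "set s \<subseteq> K" and ab: "a \<in> basis_idx (length s) d" "b \<in> basis_idx (length s) d"
    and p: "odd (count (mset (zip s a)) p + count (mset (zip s b)) p)"
  shows "rho s a b = 0"
proof -
  obtain i j where ij: "p = (i, j)" by (cases p)
  have len: "length a = length s" "length b = length s" using ab by (auto simp: basis_idx_def)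
  have "p \<in> set (zip s a) \<or> p \<in> set (zip s b)"
  proof (rule ccontr)
    assume "\<not> ?thesis"
    then have 0: "count (mset (zip s a)) p = 0" "count (mset (zip s b)) p = 0"
      by (auto simp only: count_eq_zero_iff set_mset_mset)
    show False using p unfolding 0 by simp
  qed
  then have "i \<in> set s" "j \<in> set a \<union> set b"
    unfolding ij by (auto dest: set_zip_leftD set_zip_rightD)
  then have i: "i \<in> K" and j: "j < d"
    using s ab by (auto simp: basis_idx_def)
  then obtain j' where j': "j' < d" "j' \<noteq> j" using dim_ge_2
    by (metis One_nat_def Suc_1 less_le_trans less_Suc_eq zero_less_Suc nat_neq_iff)
  \<comment> \<open>With coefficients 1 and 0 the reflection fixes the auxiliary coordinate
    \<open>j'\<close> and negates \<open>j\<close>.\<close>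
  let ?T = "row_refl i j' j 1 0 :: (nat \<Rightarrow> nat \<Rightarrow> complex) \<Rightarrow> _"
  have T: "case_prod (?T X) = (\<lambda>p'. if p' = p then - case_prod X p' else case_prod X p')" for X
    using j' by (auto simp: row_refl_def plane_refl_def ij fun_eq_iff)
  have flip: "copies_state s (?T X) c = (-1) ^ count (mset (zip s c)) p * copies_state s X c" if "length c = length s" for X c
    unfolding copies_state_eq_prod_mset[OF that] T by (rule prod_mset_flip)
  have "rho s a b = (\<integral>X. cnj (copies_state s (?T X) a) * copies_state s (?T X) b \<partial>\<mu>)"
    unfolding rho_def
    using integral_row_refl[OF i j'(1) j j'(2), of 1 0 "\<lambda>X. cnj (copies_state s X a) * copies_state s X b"]
      rho_integrable[OF s ab] by (simp add: borel_measurable_integrable)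
  also have "\<dots> = (\<integral>X. - (cnj (copies_state s X a) * copies_state s X b) \<partial>\<mu>)"
  proof (rule Bochner_Integration.integral_cong[OF refl])
    fix X
    define x y :: complex where "x = (-1) ^ count (mset (zip s a)) p" and "y = (-1) ^ count (mset (zip s b)) p"
    have "x * y = - 1"
      unfolding x_def y_def power_add[symmetric] using p by (rule neg_one_odd_power)
    moreover have "cnj x = x" by (simp add: x_def)
    ultimately have "cnj (x * u) * (y * v) = - (cnj u * v)" for u v
      by (metis (no_types, lifting) complex_cnj_mult mult.assoc mult.commute mult_minus1)
    then show "cnj (copies_state s (?T X) a) * copies_state s (?T X) b = - (cnj (copies_state s X a) * copies_state s X b)"
      unfolding flip[OF len(1)] flip[OF len(2)] x_def y_def .
  qed
  also have "\<dots> = - rho s a b" unfolding rho_def by simp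
  finally show ?thesis by simp
qed

text \<open>If all multiplicities had equal parity, those of \<open>a\<close>, being at most 1,
  would be bounded by those of \<open>b\<close>; equal sizes then force equal multisets. So some
  pair has odd total multiplicity. Only one of the two tuples has to be collision-free, which also
  covers the entries leaving the block.\<close>

lemma rho_collision_free_eq_0:
  assumes s: "set s \<subseteq> K" and a: "a \<in> collision_free s d" and b: "b \<in> basis_idx (length s) d"
    and ne: "mset (zip s a) \<noteq> mset (zip s b)"
  shows "rho s a b = 0" "rho s b a = 0"
proof -
  have a': "a \<in> basis_idx (length s) d" "distinct (zip s a)" using a by (auto simp: collision_free_def)
  have "\<exists>p. odd (count (mset (zip s a)) p + count (mset (zip s b)) p)"
  proof (rule ccontr)
    assume "\<not> ?thesis"
    then have ev: "even (count (mset (zip s a)) p + count (mset (zip s b)) p)" for p by blast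
    have le_if_even: "m \<le> n" if "m \<le> 1" "even (m + n)" for m n :: nat
      using that by presburger
    have "mset (zip s a) \<subseteq># mset (zip s b)"
    proof (rule mset_subset_eqI)
      fix p
      have "\<forall>q. count (mset (zip s a)) q = (if q \<in> set (zip s a) then 1 else 0)"
        using a'(2) by (rule distinct_count_atmost_1[THEN iffD1])
      then have "count (mset (zip s a)) p \<le> 1" by (simp only: split: if_split) simp
      then show "count (mset (zip s a)) p \<le> count (mset (zip s b)) p"
        using ev[of p] by (rule le_if_even)
    qed
    moreover have "size (mset (zip s a)) = size (mset (zip s b))"
      using a' b by (simp add: basis_idx_def)
    ultimately show False
      using ne by (metis mset_subset_size nless_le subset_mset.le_imp_less_or_eq)
  qed
  then obtain p where p: "odd (count (mset (zip s a)) p + count (mset (zip s b)) p)" ..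
  then have p': "odd (count (mset (zip s b)) p + count (mset (zip s a)) p)" by (simp add: add.commute)
  show "rho s a b = 0" "rho s b a = 0"
    using rho_odd_eq_0[OF s a'(1) b p] rho_odd_eq_0[OF s b a'(1) p'] by auto
qed

text \<open>The reflection with coefficients 0 and 1 swaps two coordinates of row \<open>i\<close>;
  on tuples this relabels just the positions that hold a copy of input \<open>i\<close>.\<close>

lemma rho_diag_swap:
  assumes s: "set s \<subseteq> K" and a: "a \<in> basis_idx (length s) d"
    and i: "i \<in> K" and j: "j < d" "j' < d" "j \<noteq> j'"
  defines "a' \<equiv> map2 (\<lambda>k x. if k = i then Transposition.transpose j j' x else x) s a"
  shows "a' \<in> basis_idx (length s) d" and "rho s a' a' = rho s a a"
proof -
  have len: "length a = length s" using a by (simp add: basis_idx_def)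
  have tr: "Transposition.transpose j j' x < d" if "x < d" for x
    using that j by (simp add: Transposition.transpose_def)
  show a': "a' \<in> basis_idx (length s) d"
    using a tr by (auto simp: basis_idx_def a'_def dest!: set_zip_rightD)
  let ?T = "row_refl i j j' 0 1 :: (nat \<Rightarrow> nat \<Rightarrow> complex) \<Rightarrow> _"
  have T: "?T X k x = X k (if k = i then Transposition.transpose j j' x else x)" for X k x
    using j by (auto simp: row_refl_def plane_refl_def Transposition.transpose_def)
  have "copies_state s (?T X) a = copies_state s X a'" for X
    using len by (simp add: copies_state_def T a'_def cong: if_cong)
  then show "rho s a' a' = rho s a a"
    unfolding rho_def
    using integral_row_refl[OF i j, of 0 1 "\<lambda>X. cnj (copies_state s X a) * copies_state s X a"]
      rho_integrable[OF s a a] by (simp add: borel_measurable_integrable)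
qed

text \<open>Induction on the Hamming distance: transposing \<open>a ! t\<close> and \<open>b ! t\<close> in the row \<open>s ! t\<close> repairs position \<open>t\<close>,
  and distinctness guarantees that it breaks no position where the two lists already agree.\<close>
lemma rho_diag_collision_free_eq:
  assumes s: "set s \<subseteq> K" and "a \<in> collision_free s d" "b \<in> collision_free s d"
  shows "rho s a a = rho s b b"
  using assms(2,3)
proof (induction "card {t. t < length s \<and> a ! t \<noteq> b ! t}" arbitrary: a rule: less_induct)
  case less
  have a: "a \<in> basis_idx (length s) d" "length a = length s" "distinct (zip s a)"
    and b: "b \<in> basis_idx (length s) d" "length b = length s" "distinct (zip s b)"
    using less.prems by (auto simp: collision_free_def basis_idx_def)
  show ?case
  proof (cases "a = b")
    case False
    then obtain t where t: "t < length s" "a ! t \<noteq> b ! t"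
      using a b by (auto simp: list_eq_iff_nth_eq)
    define i j j' where "i = s ! t" and "j = a ! t" and "j' = b ! t"
    have i: "i \<in> K" and jd: "j < d" "j' < d" "j \<noteq> j'"
      using s t a b by (auto simp: i_def j_def j'_def basis_idx_nth)
    define a' where "a' = map2 (\<lambda>k x. if k = i then Transposition.transpose j j' x else x) s a"
    have nth: "a' ! r = (if s ! r = i then Transposition.transpose j j' (a ! r) else a ! r)" if "r < length s" for r
      using that a by (simp add: a'_def)
    have a': "a' \<in> basis_idx (length s) d" and rho: "rho s a' a' = rho s a a"
      using rho_diag_swap[OF s a(1) i jd] by (auto simp: a'_def)
    have len': "length a' = length s" using a' by (simp add: basis_idx_def)
    have dist: "distinct (zip s a')"
      unfolding distinct_conv_nth
    proof (intro allI impI notI)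
      fix r r' assume r: "r < length (zip s a')" "r' < length (zip s a')" "r \<noteq> r'" "zip s a' ! r = zip s a' ! r'"
      then have "s ! r = s ! r'" "a' ! r = a' ! r'" "r < length s" "r' < length s" by (auto simp: len')
      then have "a ! r = a ! r'" using nth by (metis transpose_eq_imp_eq)
      then have "zip s a ! r = zip s a ! r'" using \<open>s ! r = s ! r'\<close> r a by (simp add: len')
      then show False using a(2,3) r by (simp add: nth_eq_iff_index_eq len' del: nth_zip)
    qed
    have "{r. r < length s \<and> a' ! r \<noteq> b ! r} \<subset> {r. r < length s \<and> a ! r \<noteq> b ! r}"
    proof (rule psubsetI)
      show "{r. r < length s \<and> a' ! r \<noteq> b ! r} \<subseteq> {r. r < length s \<and> a ! r \<noteq> b ! r}"
      proof (safe)
        fix r assume r: "r < length s" "a' ! r \<noteq> b ! r" "a ! r = b ! r"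
        then have sr: "s ! r = i" and ne: "a ! r = j \<or> a ! r = j'"
          using nth[OF r(1)] by (auto simp: Transposition.transpose_def split: if_splits)
        \<comment> \<open>A broken position \<open>r\<close> lies in row \<open>i\<close> and
          carries \<open>j\<close> or \<open>j'\<close> in both tuples. The value \<open>j\<close>
          repeats the pair at \<open>t\<close> in \<open>a\<close>, the value \<open>j'\<close> the
          pair at \<open>t\<close> in \<open>b\<close>, so both tuples must be free of
          collisions.\<close>
        have "r \<noteq> t" using r t by auto
        then have "zip s a ! r \<noteq> zip s a ! t" "zip s b ! r \<noteq> zip s b ! t"
          using a b r t by (auto simp: nth_eq_iff_index_eq simp del: nth_zip)
        then show False
          using a b r t sr ne by (auto simp: i_def j_def j'_def)
      qed
      have "a' ! t = b ! t" using nth[OF t(1)] by (simp add: i_def[symmetric] j_def[symmetric] j'_def[symmetric])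
      then show "{r. r < length s \<and> a' ! r \<noteq> b ! r} \<noteq> {r. r < length s \<and> a ! r \<noteq> b ! r}"
        using t by auto
    qed
    then have "card {r. r < length s \<and> a' ! r \<noteq> b ! r} < card {r. r < length s \<and> a ! r \<noteq> b ! r}"
      by (intro psubset_card_mono) auto
    then have "rho s a' a' = rho s b b"
      using a' dist less.prems by (intro less.hyps) (auto simp: collision_free_def)
    then show ?thesis using rho by simp
  qed simp
qed

end

section \<open>Weight of the tuples with collisions\<close>

lemma prod_pair_only:
  fixes g :: "nat \<Rightarrow> 'a::comm_monoid_mult"
  assumes "t < M" "t' < M" "t \<noteq> t'"
  shows "(\<Prod>r<M. if r \<in> {t, t'} then g r else 1) = g t * g t'"
proof -
  have "(\<Prod>r<M. if r \<in> {t, t'} then g r else 1) = (\<Prod>r\<in>{t, t'}. g r)"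
    using assms by (intro prod.mono_neutral_cong_right) auto
  then show ?thesis using assms by simp
qed

text \<open>When \<open>p r\<close> is the law of an independent draw at position \<open>r\<close>,
  this is the probability that draws \<open>t\<close> and \<open>t'\<close> coincide. Splitting by
  the common value \<open>j\<close> makes the sum over tuples factorise, and every other position
  contributes 1.\<close>

lemma collision_sum_eq:
  fixes p :: "nat \<Rightarrow> nat \<Rightarrow> real"
  assumes t: "t < M" "t' < M" "t \<noteq> t'" and one: "\<And>r. r < M \<Longrightarrow> (\<Sum>x<d. p r x) = 1"
  shows "(\<Sum>a\<in>basis_idx M d. if a ! t = a ! t' then \<Prod>r<M. p r (a ! r) else 0) = (\<Sum>j<d. p t j * p t' j)"
proof -
  let ?f = "\<lambda>j r x. p r x * (if r \<in> {t, t'} then of_bool (x = j) else 1)"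
  have "(if a ! t = a ! t' then \<Prod>r<M. p r (a ! r) else 0) = (\<Sum>j<d. \<Prod>r<M. ?f j r (a ! r))"
    if a: "a \<in> basis_idx M d" for a
  proof -
    have "(\<Sum>j<d. \<Prod>r<M. ?f j r (a ! r)) = (\<Sum>j<d. (\<Prod>r<M. p r (a ! r)) * (of_bool (a ! t = j) * of_bool (a ! t' = j)))"
      by (simp only: prod.distrib prod_pair_only[OF t])
    also have "\<dots> = (\<Sum>j<d. if j = a ! t then (if a ! t = a ! t' then \<Prod>r<M. p r (a ! r) else 0) else 0)"
      by (intro sum.cong) auto
    also have "\<dots> = (if a ! t = a ! t' then \<Prod>r<M. p r (a ! r) else 0)"
      using basis_idx_nth[OF a t(1)] by simp
    finally show ?thesis ..
  qed
  then have "(\<Sum>a\<in>basis_idx M d. if a ! t = a ! t' then \<Prod>r<M. p r (a ! r) else 0)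
      = (\<Sum>a\<in>basis_idx M d. \<Sum>j<d. \<Prod>r<M. ?f j r (a ! r))"
    by (intro sum.cong) auto
  also have "\<dots> = (\<Sum>j<d. \<Sum>a\<in>basis_idx M d. \<Prod>r<M. ?f j r (a ! r))"
    by (rule sum.swap)
  also have "\<dots> = (\<Sum>j<d. \<Prod>r<M. \<Sum>x<d. ?f j r x)"
    using sum_basis_idx_prod[of "?f _"] by (intro sum.cong refl)
  also have "\<dots> = (\<Sum>j<d. \<Prod>r<M. if r \<in> {t, t'} then p r j else 1)"
  proof (intro sum.cong prod.cong refl)
    fix j r assume j: "j \<in> {..<d}" and r: "r \<in> {..<M}"
    have "(\<Sum>x<d. ?f j r x) = (\<Sum>x<d. if r \<in> {t, t'} then (if x = j then p r x else 0) else p r x)"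
      by (intro sum.cong) auto
    then show "(\<Sum>x<d. ?f j r x) = (if r \<in> {t, t'} then p r j else 1)"
      using one[of r] j r by (cases "r \<in> {t, t'}") auto
  qed
  also have "\<dots> = (\<Sum>j<d. p t j * p t' j)"
    by (simp only: prod_pair_only[OF t])
  finally show ?thesis .
qed

text \<open>Zero extension of \<open>v\<close>, so that positivity of the full form is inherited by
  every block.\<close>

lemma quad_form_restrict:
  assumes "finite I" "J \<subseteq> I"
  shows "quad_form J F v = quad_form I F (\<lambda>a. if a \<in> J then v a else 0)"
proof -
  have "(\<Sum>a\<in>J. \<Sum>b\<in>J. cnj (v a) * F a b * v b)
      = (\<Sum>a\<in>I. \<Sum>b\<in>I. cnj (if a \<in> J then v a else 0) * F a b * (if b \<in> J then v b else 0))"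
    using assms
    by (intro sum.mono_neutral_cong_left) (auto intro!: sum.mono_neutral_cong_left sum.neutral)
  then show ?thesis unfolding quad_form_def by simp
qed

context refl_invariant_array begin

text \<open>The probability of reading \<open>a\<close> when the averaged state is measured in the
  computational basis.\<close>

definition weight :: "nat list \<Rightarrow> nat list \<Rightarrow> real" where
  "weight s a = (\<integral>X. (\<Prod>t<length s. (cmod (X (s ! t) (a ! t)))\<^sup>2) \<partial>\<mu>)"

lemma norm_copies_state: "cnj (copies_state s X a) * copies_state s X a = of_real (\<Prod>t<length s. (cmod (X (s ! t) (a ! t)))\<^sup>2)"
proof -
  have "cnj (copies_state s X a) * copies_state s X a = of_real ((cmod (copies_state s X a))\<^sup>2)"
    by (simp add: complex_norm_square mult.commute del: of_real_power)
  then show ?thesis by (simp add: copies_state_def prod_norm[symmetric] prod_power_distrib)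
qed

lemma rho_diag: "rho s a a = of_real (weight s a)"
  unfolding rho_def weight_def norm_copies_state by (rule integral_complex_of_real)

lemma has_bochner_integral_weight:
  assumes "set s \<subseteq> K" "a \<in> basis_idx (length s) d"
  shows "has_bochner_integral \<mu> (\<lambda>X. \<Prod>t<length s. (cmod (X (s ! t) (a ! t)))\<^sup>2) (weight s a)"
proof -
  have "integrable \<mu> (\<lambda>X. Re (cnj (copies_state s X a) * copies_state s X a))"
    using rho_integrable[OF assms assms(2)] by (rule integrable_Re)
  then show ?thesis
    unfolding norm_copies_state weight_def Re_complex_of_real by (simp add: has_bochner_integral_iff)
qed

lemma weight_nonneg: "0 \<le> weight s a"
  unfolding weight_def by (intro integral_nonneg_AE) (auto intro!: prod_nonneg)

lemma sum_weight:
  assumes "set s \<subseteq> K"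
  shows "(\<Sum>a\<in>basis_idx (length s) d. weight s a) = 1"
proof -
  have hb: "has_bochner_integral \<mu> (\<lambda>X. \<Sum>a\<in>basis_idx (length s) d. \<Prod>t<length s. (cmod (X (s ! t) (a ! t)))\<^sup>2)
     (\<Sum>a\<in>basis_idx (length s) d. weight s a)"
    by (intro has_bochner_integral_sum has_bochner_integral_weight assms)
  have "AE X in \<mu>. (\<Sum>a\<in>basis_idx (length s) d. \<Prod>t<length s. (cmod (X (s ! t) (a ! t)))\<^sup>2) = 1"
    using AE_rows
  proof eventually_elim
    case (elim X)
    have "(\<Sum>a\<in>basis_idx (length s) d. \<Prod>t<length s. (cmod (X (s ! t) (a ! t)))\<^sup>2) = (\<Prod>t<length s. \<Sum>j<d. (cmod (X (s ! t) j))\<^sup>2)"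
      by (rule sum_basis_idx_prod)
    also have "\<dots> = 1" using elim assms by (intro prod.neutral) (auto simp: subset_iff)
    finally show ?case .
  qed
  then have "(\<integral>X. (\<Sum>a\<in>basis_idx (length s) d. \<Prod>t<length s. (cmod (X (s ! t) (a ! t)))\<^sup>2) \<partial>\<mu>) = (\<integral>X. 1 \<partial>\<mu>)"
    using borel_measurable_has_bochner_integral[OF hb] by (intro integral_cong_AE) auto
  then show ?thesis
    using has_bochner_integral_integral_eq[OF hb] by (simp add: prob_space)
qed

text \<open>For a fixed array the positions are independent draws with probabilities given by
  squared moduli. Two draws from the same row coincide with probability the sum of the fourth
  powers, whose mean is bounded by \<open>sum_fourth_moments_le\<close>.\<close>

lemma sum_weight_collision_le:
  assumes s: "set s \<subseteq> K" and t: "t < length s" "t' < length s" "t \<noteq> t'" "s ! t = s ! t'"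
  shows "(\<Sum>a\<in>basis_idx (length s) d. if a ! t = a ! t' then weight s a else 0) \<le> 3 / d"
proof -
  have i: "s ! t \<in> K" using s t by auto
  let ?g = "\<lambda>X. \<Sum>a\<in>basis_idx (length s) d. if a ! t = a ! t' then \<Prod>t<length s. (cmod (X (s ! t) (a ! t)))\<^sup>2 else 0"
  let ?h = "\<lambda>X. \<Sum>j<d. (cmod (X (s ! t) j))\<^sup>2 * (cmod (X (s ! t) j))\<^sup>2"
  have hb: "has_bochner_integral \<mu> ?g (\<Sum>a\<in>basis_idx (length s) d. if a ! t = a ! t' then weight s a else 0)"
  proof (rule has_bochner_integral_sum)
    fix a assume "a \<in> basis_idx (length s) d"
    then show "has_bochner_integral \<mu> (\<lambda>X. if a ! t = a ! t' then \<Prod>t<length s. (cmod (X (s ! t) (a ! t)))\<^sup>2 else 0)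
        (if a ! t = a ! t' then weight s a else 0)"
      using has_bochner_integral_weight[OF s] by (cases "a ! t = a ! t'") auto
  qed
  have hq: "has_bochner_integral \<mu> ?h (\<Sum>j<d. sq_corr (s ! t) j j)"
    by (intro has_bochner_integral_sum has_bochner_integral_sq_corr i) auto
  have "AE X in \<mu>. ?g X = ?h X"
    using AE_rows
  proof eventually_elim
    case (elim X)
    have "?g X = (\<Sum>j<d. (cmod (X (s ! t) j))\<^sup>2 * (cmod (X (s ! t') j))\<^sup>2)"
      using elim s by (intro collision_sum_eq[OF t(1-3)]) (auto simp: subset_iff)
    then show ?case by (simp add: t(4))
  qed
  then have "(\<integral>X. ?g X \<partial>\<mu>) = (\<integral>X. ?h X \<partial>\<mu>)"
    using borel_measurable_has_bochner_integral[OF hb] borel_measurable_has_bochner_integral[OF hq]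
    by (intro integral_cong_AE)
  then show ?thesis
    using has_bochner_integral_integral_eq[OF hb] has_bochner_integral_integral_eq[OF hq] sum_fourth_moments_le[OF i]
    by simp
qed

text \<open>A union bound over ordered pairs of positions; there are at most
  \<open>(length s)\<^sup>2\<close> of them, a crude count that suffices for the order of
  growth.\<close>

lemma sum_weight_collision_free_ge:
  assumes s: "set s \<subseteq> K"
  shows "1 - 3 * (real (length s))\<^sup>2 / d \<le> (\<Sum>a\<in>collision_free s d. weight s a)"
proof -
  let ?I = "basis_idx (length s) d" and ?M = "length s"
  define P where "P = {(t, t'). t < ?M \<and> t' < ?M \<and> t \<noteq> t' \<and> s ! t = s ! t'}"
  have P: "P \<subseteq> {..<?M} \<times> {..<?M}" by (auto simp: P_def)
  then have finP: "finite P" by (rule finite_subset) simp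
  have "card P \<le> card ({..<?M} \<times> {..<?M})"
    using P by (rule card_mono[rotated]) simp
  then have cardP: "real (card P) \<le> (real ?M)\<^sup>2"
    unfolding power2_eq_square of_nat_mult[symmetric] of_nat_le_iff by simp
  have "(\<Sum>a\<in>?I - collision_free s d. weight s a) \<le> (\<Sum>a\<in>?I - collision_free s d. \<Sum>(t, t')\<in>P. if a ! t = a ! t' then weight s a else 0)"
  proof (rule sum_mono)
    fix a assume "a \<in> ?I - collision_free s d"
    then have "\<not> distinct (zip s a)" and len: "length a = ?M" by (auto simp: collision_free_def basis_idx_def)
    then obtain t t' where "t < ?M" "t' < ?M" "t \<noteq> t'" "s ! t = s ! t'" and eq: "a ! t = a ! t'"
      by (auto simp: distinct_conv_nth)
    then have p: "(t, t') \<in> P" by (simp add: P_def)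
    have "(case (t, t') of (t, t') \<Rightarrow> if a ! t = a ! t' then weight s a else 0)
        \<le> (\<Sum>(t, t')\<in>P. if a ! t = a ! t' then weight s a else 0)"
      using p finP by (intro member_le_sum) (auto simp: weight_nonneg split: if_splits)
    then show "weight s a \<le> (\<Sum>(t, t')\<in>P. if a ! t = a ! t' then weight s a else 0)"
      using eq by simp
  qed
  also have "\<dots> \<le> (\<Sum>a\<in>?I. \<Sum>(t, t')\<in>P. if a ! t = a ! t' then weight s a else 0)"
    using weight_nonneg by (intro sum_mono2) (auto intro!: sum_nonneg)
  also have "\<dots> = (\<Sum>(t, t')\<in>P. \<Sum>a\<in>?I. if a ! t = a ! t' then weight s a else 0)"
    by (subst sum.swap) (simp add: case_prod_beta)
  also have "\<dots> \<le> (\<Sum>(t, t')\<in>P. 3 / d)"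
    by (rule sum_mono) (auto simp: P_def intro!: sum_weight_collision_le s)
  also have "\<dots> = real (card P) * (3 / d)" by simp
  also have "\<dots> \<le> (real ?M)\<^sup>2 * (3 / d)" using cardP by (intro mult_right_mono) auto
  finally have "(\<Sum>a\<in>?I - collision_free s d. weight s a) \<le> 3 * (real ?M)\<^sup>2 / d" by (simp add: mult.commute)
  moreover have "(\<Sum>a\<in>?I. weight s a) = (\<Sum>a\<in>?I - collision_free s d. weight s a) + (\<Sum>a\<in>collision_free s d. weight s a)"
    by (intro sum.subset_diff) (auto simp: collision_free_def)
  ultimately show ?thesis using sum_weight[OF s] by simp
qed

section \<open>Measurements on the collision-free block\<close>

lemma rho_collision_free_block:
  assumes s: "set s \<subseteq> K" and a: "a \<in> collision_free s d" and b: "b \<in> collision_free s d"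
  shows "rho s a b = (if mset (zip s a) = mset (zip s b) then of_real (weight s a) else 0)"
proof (cases "mset (zip s a) = mset (zip s b)")
  case True
  have "copies_state s X b = copies_state s X a" for X
    using a b True by (simp add: copies_state_eq_prod_mset collision_free_def basis_idx_def)
  then show ?thesis using True rho_diag[of s a] by (simp add: rho_def)
next
  case False
  then show ?thesis using rho_collision_free_eq_0(1)[OF s a _ False] b by (simp add: collision_free_def)
qed

lemma integral_quad_form_collision_free:
  assumes s: "set s \<subseteq> K" and W: "\<And>a. a \<in> collision_free s d \<Longrightarrow> weight s a = W"
  shows "(\<integral>X. quad_form (collision_free s d) F (copies_state s X) \<partial>\<mu>) = W * class_sum s d F"
proof -
  have "(\<integral>X. quad_form (collision_free s d) F (copies_state s X) \<partial>\<mu>)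
      = Re (\<Sum>a\<in>collision_free s d. \<Sum>b\<in>collision_free s d. F a b * rho s a b)"
    by (rule integral_quad_form(2)[OF s]) (auto simp: collision_free_def)
  also have "(\<Sum>a\<in>collision_free s d. \<Sum>b\<in>collision_free s d. F a b * rho s a b)
      = of_real W * (\<Sum>a\<in>collision_free s d. \<Sum>b\<in>collision_free s d. if mset (zip s a) = mset (zip s b) then F a b else 0)"
    unfolding sum_distrib_left using W by (intro sum.cong) (auto simp: rho_collision_free_block[OF s])
  finally show ?thesis by (simp add: class_sum_def)
qed

text \<open>The mean of the form splits into the collision-free block, evaluated exactly, and the
  complementary block, which is nonnegative because \<open>F\<close> is positive
  semidefinite.\<close>

lemma integral_quad_form_ge:
  assumes s: "set s \<subseteq> K" and W: "\<And>a. a \<in> collision_free s d \<Longrightarrow> weight s a = W"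
    and psd: "\<And>v. 0 \<le> quad_form (basis_idx (length s) d) F v"
  shows "0 \<le> W * class_sum s d F"
    and "W * class_sum s d F \<le> (\<integral>X. quad_form (basis_idx (length s) d) F (copies_state s X) \<partial>\<mu>)"
proof -
  let ?I = "basis_idx (length s) d" and ?G = "collision_free s d"
  have G: "?G \<subseteq> ?I" and finG: "finite ?G" by (auto simp: collision_free_def)
  have nonneg: "0 \<le> (\<integral>X. quad_form J F (copies_state s X) \<partial>\<mu>)" if "J \<subseteq> ?I" for J
    unfolding quad_form_restrict[OF finite_basis_idx that] by (intro integral_nonneg_AE) (simp add: psd)
  show "0 \<le> W * class_sum s d F"
    using nonneg[OF G] integral_quad_form_collision_free[OF s W] by simp
  have ortho: "rho s a b = 0" if "a \<in> ?G \<and> b \<in> ?I - ?G \<or> b \<in> ?G \<and> a \<in> ?I - ?G" for a b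
  proof -
    have "mset (zip s a) \<noteq> mset (zip s b)"
    proof
      assume "mset (zip s a) = mset (zip s b)"
      then have "distinct (zip s a) = distinct (zip s b)" by (rule mset_eq_imp_distinct_iff)
      then show False using that by (auto simp: collision_free_def)
    qed
    then show ?thesis using that rho_collision_free_eq_0[OF s, of a b] rho_collision_free_eq_0[OF s, of b a] by auto
  qed
  have split: "(\<Sum>b\<in>?I. g b) = (\<Sum>b\<in>?G. g b) + (\<Sum>b\<in>?I - ?G. g b)" for g :: "_ \<Rightarrow> complex"
    using sum.subset_diff[OF G finite_basis_idx, of g] by (simp add: add.commute)
  have "(\<Sum>a\<in>?I. \<Sum>b\<in>?I. F a b * rho s a b)
      = (\<Sum>a\<in>?G. \<Sum>b\<in>?G. F a b * rho s a b) + (\<Sum>a\<in>?I - ?G. \<Sum>b\<in>?I - ?G. F a b * rho s a b)"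
  proof -
    have "(\<Sum>b\<in>?I. F a b * rho s a b) = (\<Sum>b\<in>?G. F a b * rho s a b)" if "a \<in> ?G" for a
      unfolding split[of "\<lambda>b. F a b * rho s a b"] using ortho that by simp
    moreover have "(\<Sum>b\<in>?I. F a b * rho s a b) = (\<Sum>b\<in>?I - ?G. F a b * rho s a b)" if "a \<in> ?I - ?G" for a
      unfolding split[of "\<lambda>b. F a b * rho s a b"] using ortho that by simp
    ultimately show ?thesis
      unfolding split[of "\<lambda>a. \<Sum>b\<in>?I. F a b * rho s a b"] by simp
  qed
  then have "(\<integral>X. quad_form ?I F (copies_state s X) \<partial>\<mu>)
     = (\<integral>X. quad_form ?G F (copies_state s X) \<partial>\<mu>) + (\<integral>X. quad_form (?I - ?G) F (copies_state s X) \<partial>\<mu>)"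
    using G by (simp add: integral_quad_form(2)[OF s])
  then show "W * class_sum s d F \<le> (\<integral>X. quad_form ?I F (copies_state s X) \<partial>\<mu>)"
    using nonneg[of "?I - ?G"] integral_quad_form_collision_free[OF s W] by simp
qed

text \<open>Completeness of the measurement cancels the off-diagonal entries and leaves 1 for each
  diagonal one. The total does not refer to the distribution, so it can be shared by two special
  indices.\<close>

lemma sum_class_sum_povm:
  assumes "is_povm (basis_idx (length s) d) C E"
  shows "(\<Sum>k\<in>{1..C}. class_sum s d (E k)) = card (collision_free s d)"
proof -
  let ?G = "collision_free s d"
  have G: "?G \<subseteq> basis_idx (length s) d" and finG: "finite ?G" by (auto simp: collision_free_def)
  have E: "(\<Sum>k\<in>{1..C}. E k a b) = (if a = b then 1 else 0)" if "a \<in> ?G" "b \<in> ?G" for a b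
    using assms that G unfolding is_povm_def by blast
  have "(\<Sum>k\<in>{1..C}. class_sum s d (E k)) =
      Re (\<Sum>a\<in>?G. \<Sum>b\<in>?G. \<Sum>k\<in>{1..C}. if mset (zip s a) = mset (zip s b) then E k a b else 0)"
    unfolding class_sum_def Re_sum[symmetric]
    by (subst sum.swap, intro arg_cong[where f=Re] sum.cong refl, rule sum.swap)
  also have "(\<Sum>a\<in>?G. \<Sum>b\<in>?G. \<Sum>k\<in>{1..C}. if mset (zip s a) = mset (zip s b) then E k a b else 0)
      = (\<Sum>a\<in>?G. \<Sum>b\<in>?G. if a = b then 1 else 0)"
  proof (intro sum.cong refl)
    fix a b assume "a \<in> ?G" "b \<in> ?G"
    then show "(\<Sum>k\<in>{1..C}. if mset (zip s a) = mset (zip s b) then E k a b else 0) = (if a = b then 1 else 0)"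
      using E[of a b] by (cases "mset (zip s a) = mset (zip s b)") auto
  qed
  also have "\<dots> = of_nat (card ?G)" using finG by simp
  finally show ?thesis by simp
qed

lemma sum_success_povm:
  assumes s: "set s \<subseteq> K" and povm: "is_povm (basis_idx (length s) d) C E"
  shows "(\<Sum>k\<in>{1..C}. \<integral>X. quad_form (basis_idx (length s) d) (E k) (copies_state s X) \<partial>\<mu>) = 1"
proof -
  let ?I = "basis_idx (length s) d"
  have E: "(\<Sum>k\<in>{1..C}. E k a b) = (if a = b then 1 else 0)" if "a \<in> ?I" "b \<in> ?I" for a b
    using povm that unfolding is_povm_def by blast
  have "(\<Sum>k\<in>{1..C}. \<integral>X. quad_form ?I (E k) (copies_state s X) \<partial>\<mu>)
      = Re (\<Sum>a\<in>?I. \<Sum>b\<in>?I. \<Sum>k\<in>{1..C}. E k a b * rho s a b)"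
    unfolding integral_quad_form(2)[OF s order_refl] Re_sum[symmetric]
    by (subst sum.swap, intro arg_cong[where f=Re] sum.cong refl, rule sum.swap)
  also have "(\<Sum>a\<in>?I. \<Sum>b\<in>?I. \<Sum>k\<in>{1..C}. E k a b * rho s a b) = (\<Sum>a\<in>?I. \<Sum>b\<in>?I. if a = b then of_real (weight s a) else 0)"
    unfolding sum_distrib_right[symmetric] using E by (intro sum.cong) (auto simp: rho_diag)
  also have "\<dots> = of_real (\<Sum>a\<in>?I. weight s a)" by simp
  finally show ?thesis using sum_weight[OF s] by simp
qed

text \<open>The failure probability is the total probability of the wrong outcomes. Bounding it from
  below is the useful direction: discarding the complementary block only loses probability, and the
  class sums of the wrong outcomes add up to the cardinality minus that of
  \<open>E k\<close>.\<close>

lemma povm_failure_ge: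
  assumes s: "set s \<subseteq> K" and povm: "is_povm (basis_idx (length s) d) C E" and k: "k \<in> {1..C}"
  obtains W :: real where "0 \<le> W" "1 - 3 * (real (length s))\<^sup>2 / d \<le> W * card (collision_free s d)"
    and "\<forall>k'\<in>{1..C}. 0 \<le> W * class_sum s d (E k')"
    and "W * (real (card (collision_free s d)) - class_sum s d (E k))
       \<le> 1 - (\<integral>X. outcome_prob (basis_idx (length s) d) E k (copies_state s X) \<partial>\<mu>)"
proof -
  let ?I = "basis_idx (length s) d"
  \<comment> \<open>The common value of the weights. Without collision-free tuples the default 0
    works, since then \<open>sum_weight_collision_free_ge\<close> already makes the lower bound at
    most 0.\<close>
  define W where "W = (if collision_free s d = {} then 0 else weight s (SOME a. a \<in> collision_free s d))"
  have W: "weight s a = W" if a: "a \<in> collision_free s d" for a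
  proof -
    have "(SOME a. a \<in> collision_free s d) \<in> collision_free s d" using a by (rule someI)
    then show ?thesis
      using rho_diag_collision_free_eq[OF s a] a unfolding rho_diag W_def by auto
  qed
  have psd: "0 \<le> quad_form ?I (E k') v" if "k' \<in> {1..C}" for k' v
    using povm that unfolding is_povm_def quad_form_def by blast
  note ge = integral_quad_form_ge[OF s W psd]
  have "W * (real (card (collision_free s d)) - class_sum s d (E k)) = (\<Sum>k'\<in>{1..C} - {k}. W * class_sum s d (E k'))"
    using sum_class_sum_povm[OF povm] k by (simp add: sum_diff1 sum_distrib_left[symmetric])
  also have "\<dots> \<le> (\<Sum>k'\<in>{1..C} - {k}. \<integral>X. quad_form ?I (E k') (copies_state s X) \<partial>\<mu>)"
    by (intro sum_mono ge(2)) auto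
  also have "\<dots> = 1 - (\<integral>X. quad_form ?I (E k) (copies_state s X) \<partial>\<mu>)"
    using sum_success_povm[OF s povm] k by (simp add: sum_diff1)
  finally have fail: "W * (real (card (collision_free s d)) - class_sum s d (E k)) \<le> 1 - (\<integral>X. quad_form ?I (E k) (copies_state s X) \<partial>\<mu>)" .
  show thesis
  proof (rule that[of W])
    show "0 \<le> W" by (simp add: W_def weight_nonneg)
    show "1 - 3 * (real (length s))\<^sup>2 / d \<le> W * card (collision_free s d)"
      using sum_weight_collision_free_ge[OF s] W by (simp add: mult.commute)
    show "\<forall>k'\<in>{1..C}. 0 \<le> W * class_sum s d (E k')"
      using ge(1) by blast
  qed (use fail in \<open>simp add: quad_form_def outcome_prob_def\<close>)
qed

end

section \<open>The input distribution\<close>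

lemma row_refl_measurable_PiM:
  assumes "i \<in> K" and "plane_refl j j' c s \<in> measurable (N i) (N i)"
  shows "row_refl i j j' c s \<in> measurable (PiM K N) (PiM K N)"
proof -
  have "(\<lambda>X. plane_refl j j' c s (X i)) \<in> measurable (PiM K N) (N i)"
    using measurable_component_singleton[OF assms(1)] assms(2) by (rule measurable_compose)
  moreover have "insert i K = K" using assms(1) by auto
  ultimately show ?thesis
    unfolding row_refl_def by (intro measurable_fun_upd[where J=K]) auto
qed

text \<open>Boxes determine the product measure, and pulling a box back changes only its side
  \<open>i\<close>, where the invariance of \<open>N i\<close> applies.\<close>

lemma distr_PiM_row_refl:
  assumes K: "finite K" and i: "i \<in> K" and prob: "\<And>k. prob_space (N k)"
    and T: "plane_refl j j' c s \<in> measurable (N i) (N i)"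
    and inv: "distr (N i) (N i) (plane_refl j j' c s) = N i"
  shows "distr (PiM K N) (PiM K N) (row_refl i j j' c s) = PiM K N"
proof -
  interpret product_prob_space N K
    by (intro product_prob_spaceI prob)
  show ?thesis
  proof (rule PiM_eqI[OF K])
    fix A assume A: "\<And>k. k \<in> K \<Longrightarrow> A k \<in> sets (N k)"
    define B where "B = A(i := plane_refl j j' c s -` A i \<inter> space (N i))"
    have B: "B k \<in> sets (N k)" if "k \<in> K" for k
      using A that T i by (auto simp: B_def intro: measurable_sets)
    have "row_refl i j j' c s -` PiE K A \<inter> space (PiM K N) = PiE K B"
    proof (intro set_eqI iffI)
      fix X assume "X \<in> row_refl i j j' c s -` PiE K A \<inter> space (PiM K N)"
      then have X: "row_refl i j j' c s X \<in> PiE K A" "X \<in> space (PiM K N)" by auto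
      have "X k \<in> B k" if "k \<in> K" for k
        using PiE_mem[OF X(1) that] X(2) that
        by (auto simp: B_def row_refl_def space_PiM PiE_iff split: if_splits)
      then show "X \<in> PiE K B" using X(2) by (auto simp: space_PiM PiE_iff)
    next
      fix X assume X: "X \<in> PiE K B"
      have "X k \<in> space (N k)" if "k \<in> K" for k
        using PiE_mem[OF X that] sets.sets_into_space[OF B[OF that]] by auto
      moreover have "row_refl i j j' c s X k \<in> A k" if "k \<in> K" for k
        using PiE_mem[OF X that] by (auto simp: B_def row_refl_def split: if_splits)
      moreover have "row_refl i j j' c s X \<in> extensional K"
        using X i by (auto simp: row_refl_def PiE_iff extensional_def)
      ultimately show "X \<in> row_refl i j j' c s -` PiE K A \<inter> space (PiM K N)"
        using X by (auto simp: space_PiM PiE_iff)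
    qed
    then have "emeasure (distr (PiM K N) (PiM K N) (row_refl i j j' c s)) (PiE K A) = emeasure (PiM K N) (PiE K B)"
      using A K by (subst emeasure_distr) (auto intro!: row_refl_measurable_PiM[where N=N, OF i T] sets_PiM_I_finite)
    also have "\<dots> = (\<Prod>k\<in>K. emeasure (N k) (B k))"
      using B by (rule emeasure_PiM[OF K])
    also have "\<dots> = (\<Prod>k\<in>K. emeasure (N k) (A k))"
    proof (intro prod.cong refl)
      fix k assume k: "k \<in> K"
      show "emeasure (N k) (B k) = emeasure (N k) (A k)"
        using emeasure_distr[OF T A[OF i]] inv by (simp add: B_def)
    qed
    finally show "emeasure (distr (PiM K N) (PiM K N) (row_refl i j j' c s)) (PiE K A) = (\<Prod>k\<in>K. emeasure (N k) (A k))" .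
  qed simp
qed

lemma embed_measurable:
  "(\<lambda>x. restrict (\<lambda>i. complex_of_real (x i)) {..<d}) \<in> measurable (lborel_PiM {..<d}) (lborel_PiM {..<d})"
proof (rule measurable_restrict)
  fix i assume "i \<in> {..<d}"
  then show "(\<lambda>x. complex_of_real (x i)) \<in> measurable (lborel_PiM {..<d}) lborel"
    using lborel_PiM_component_measurable[of i "{..<d}"] by simp
qed

lemma unif_sphere_real_in_cplx_eq:
  "unif_sphere_real_in_cplx d = distr (unif_sphere d) (lborel_PiM {..<d}) (\<lambda>x. restrict (\<lambda>i. complex_of_real (x i)) {..<d})"
  unfolding unif_sphere_real_in_cplx_def unif_sphere_real_eq cplx_space_def ..

text \<open>Since \<open>c\<close> and \<open>s\<close> are real, the reflection commutes with the
  embedding of real vectors into complex ones, which carries the invariance of the real sphere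
  over.\<close>

lemma input_component_properties:
  assumes d: "d > 0" and N: "N = unif_sphere_real_in_cplx d \<or> N = unif_sphere_cplx d"
  shows "prob_space N" and "sets N = sets (lborel_PiM {..<d})"
    and "AE x in N. (\<Sum>j<d. (cmod (x j))\<^sup>2) = 1"
    and "j < d \<Longrightarrow> j' < d \<Longrightarrow> j \<noteq> j' \<Longrightarrow> c\<^sup>2 + s\<^sup>2 = 1 \<Longrightarrow> distr N N (plane_refl j j' c s) = N"
proof -
  let ?e = "\<lambda>x. restrict (\<lambda>i. complex_of_real (x i)) {..<d}"
  let ?M = "lborel_PiM {..<d} :: (nat \<Rightarrow> complex) measure" and ?R = "lborel_PiM {..<d} :: (nat \<Rightarrow> real) measure"
  have e: "?e \<in> measurable (unif_sphere d) ?M"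
    using embed_measurable by (simp cong: measurable_cong_sets)
  have comp: "(\<lambda>x. x k) \<in> borel_measurable ?M" if "k \<in> {..<d}" for k
    using that by (rule lborel_PiM_component_measurable)
  show "prob_space N"
    using N prob_space_unif_sphere[OF d, where 'a=real] prob_space_unif_sphere[OF d, where 'a=complex] e
    by (auto simp: unif_sphere_real_in_cplx_eq unif_sphere_cplx_eq intro: prob_space.prob_space_distr)
  show sets: "sets N = sets ?M"
    using N by (auto simp: unif_sphere_real_in_cplx_eq unif_sphere_cplx_eq)
  show "AE x in N. (\<Sum>j<d. (cmod (x j))\<^sup>2) = 1"
  proof (cases "N = unif_sphere_cplx d")
    case True
    show ?thesis unfolding True unif_sphere_cplx_eq using d by (rule AE_unif_sphere_norm)
  next
    case False
    note [measurable] = comp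
    have "AE x in unif_sphere d. (\<Sum>j<d. (cmod (?e x j))\<^sup>2) = 1"
      using AE_unif_sphere_norm[OF d, where 'a=real] by eventually_elim simp
    moreover have "{x \<in> space ?M. (\<Sum>j<d. (cmod (x j))\<^sup>2) = 1} \<in> sets ?M" by measurable
    moreover have "N = distr (unif_sphere d) ?M ?e" using False N by (simp add: unif_sphere_real_in_cplx_eq)
    ultimately show ?thesis
      by (simp only: AE_distr_iff[OF e])
  qed
  assume ij: "j < d" "j' < d" "j \<noteq> j'" "c\<^sup>2 + s\<^sup>2 = 1"
  have TM: "plane_refl j j' c s \<in> measurable ?M ?M" and TR: "plane_refl j j' c s \<in> measurable ?R ?R"
    using ij by (auto intro: plane_refl_measurable)
  have "distr N ?M (plane_refl j j' c s) = N"
  proof (cases "N = unif_sphere_cplx d")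
    case True
    then show ?thesis using distr_unif_sphere_plane_refl[OF ij, where 'a=complex] by (simp add: unif_sphere_cplx_eq)
  next
    case False
    then have Neq: "N = distr (unif_sphere d) ?M ?e" using N by (simp add: unif_sphere_real_in_cplx_eq)
    have comm: "plane_refl j j' c s (?e x) = ?e (plane_refl j j' c s x)" for x
      using ij by (auto simp: plane_refl_def fun_eq_iff scaleR_conv_of_real)
    have TR': "plane_refl j j' c s \<in> measurable (unif_sphere d) ?R"
      using TR by (simp cong: measurable_cong_sets)
    have "distr N ?M (plane_refl j j' c s) = distr (unif_sphere d) ?M (\<lambda>x. plane_refl j j' c s (?e x))"
      unfolding Neq using TM e by (subst distr_distr) (auto simp: comp_def)
    also have "\<dots> = distr (distr (unif_sphere d) ?R (plane_refl j j' c s)) ?M ?e"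
      using TR' embed_measurable by (subst distr_distr) (auto simp: comp_def comm)
    finally show ?thesis using distr_unif_sphere_plane_refl[OF ij, where 'a=real] Neq by simp
  qed
  then show "distr N N (plane_refl j j' c s) = N"
    using distr_cong[OF refl sets[symmetric], of N "plane_refl j j' c s"] sets by metis
qed

lemma refl_invariant_array_input_dist:
  assumes d: "2 \<le> d"
  shows "refl_invariant_array (input_dist C d k) {1..C} d"
proof -
  define N where "N i = (if i = k then unif_sphere_real_in_cplx d else unif_sphere_cplx d)" for i :: nat
  have eq: "input_dist C d k = PiM {1..C} N" by (simp only: input_dist_def N_def[abs_def])
  have Ni: "N i = unif_sphere_real_in_cplx d \<or> N i = unif_sphere_cplx d" for i by (auto simp: N_def)
  note props = input_component_properties[OF _ Ni]
  have prob: "prob_space (N i)" for i using d by (intro props) auto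
  have T: "plane_refl j j' c s \<in> measurable (N i) (N i)" if "j < d" "j' < d" for j j' c s i
    using plane_refl_measurable[of j "{..<d}" j' c s, where 'a=complex] props(2) that d
    by (simp cong: measurable_cong_sets)
  show ?thesis
  proof (intro refl_invariant_array.intro refl_invariant_array_axioms.intro)
    show "prob_space (input_dist C d k)"
      unfolding eq by (intro prob_space_PiM prob)
  next
    fix i j assume i: "i \<in> {1..C}" and j: "j < d"
    have "(\<lambda>x. x j) \<in> borel_measurable (N i)"
      using lborel_PiM_component_measurable[of j "{..<d}", where 'a=complex] props(2) j d
      by (simp cong: measurable_cong_sets)
    then show "(\<lambda>X. X i j) \<in> borel_measurable (input_dist C d k)"
      unfolding eq using measurable_component_singleton[OF i] by (rule measurable_compose[rotated])
  next
    fix i assume i: "i \<in> {1..C}"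
    show "AE X in input_dist C d k. (\<Sum>j<d. (cmod (X i j))\<^sup>2) = 1"
      unfolding eq using d by (intro AE_PiM_component[OF prob i] props(3)) auto
  next
    fix i j j' :: nat and c s :: real
    assume i: "i \<in> {1..C}" and j: "j < d" "j' < d" "j \<noteq> j'" "c\<^sup>2 + s\<^sup>2 = 1"
    show "row_refl i j j' c s \<in> measurable (input_dist C d k) (input_dist C d k)"
      unfolding eq using T[OF j(1,2)] by (rule row_refl_measurable_PiM[OF i])
    show "distr (input_dist C d k) (input_dist C d k) (row_refl i j j' c s) = input_dist C d k"
      unfolding eq using j d by (intro distr_PiM_row_refl i prob T props(4)) auto
  qed (rule d)
qed

section \<open>Comparison of two special indices\<close>

text \<open>The unknown scales are eliminated by \<open>\<delta> \<le> W * g\<close>: each failure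
  bound becomes \<open>\<delta> * (g - l) \<le> 0.1 * g\<close>. Adding the two and using
  \<open>l1 + l2 \<le> g\<close> yields \<open>\<delta> * g \<le> 0.2 * g\<close>, contrary to
  \<open>0.2 < \<delta>\<close>.\<close>

lemma two_povm_bound:
  fixes g :: real
  assumes "0 \<le> W1" "0 \<le> W2" "\<delta> \<le> W1 * g" "\<delta> \<le> W2 * g" "0.2 < \<delta>"
    and "W1 * (g - l1) \<le> 0.1" "W2 * (g - l2) \<le> 0.1" "l1 + l2 \<le> g"
  shows False
proof -
  have W: "W1 > 0" "W2 > 0" using assms by (auto simp: less_le)
  have "0 < W1 * g" using assms by linarith
  then have g: "g > 0" using W by (simp add: zero_less_mult_iff)
  have "\<delta> * (g - l) \<le> 0.1 * g" if "W > 0" "\<delta> \<le> W * g" "W * (g - l) \<le> 0.1" for W l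
  proof (cases "g - l \<ge> 0")
    case True
    then have "\<delta> * (g - l) \<le> (W * g) * (g - l)" using that by (intro mult_right_mono) auto
    also have "\<dots> = g * (W * (g - l))" by (simp add: mult_ac)
    also have "\<dots> \<le> g * 0.1" using that g by (intro mult_left_mono) auto
    finally show ?thesis by simp
  next
    case False
    then have "\<delta> * (g - l) \<le> 0" using assms(5) by (intro mult_nonneg_nonpos) auto
    then show ?thesis using g by linarith
  qed
  from this[OF W(1) assms(3,6)] this[OF W(2) assms(4,7)]
  have "\<delta> * ((g - l1) + (g - l2)) \<le> 0.2 * g" unfolding distrib_left by linarith
  moreover have "\<delta> * g \<le> \<delta> * ((g - l1) + (g - l2))" using assms by (intro mult_left_mono) auto
  moreover have "0.2 * g < \<delta> * g" using assms g by (intro mult_strict_right_mono) auto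
  ultimately show False by linarith
qed

theorem theorem1:
  fixes C :: nat
  assumes "C \<ge> 2"
  shows "\<exists>c>0. \<exists>N. \<forall>n\<ge>max 1 N. \<forall>(s :: nat list) E.
           set s \<subseteq> {1..C} \<longrightarrow>
           is_povm (basis_idx (length s) (2^n)) C E \<longrightarrow>
           (\<forall>k\<in>{1..C}. success_prob C n s E k \<ge> 0.9) \<longrightarrow>
           real (length s) \<ge> c * 2 powr (real n / 2)"
proof (intro exI[of _ "1/2 :: real"] conjI exI[of _ "0::nat"] allI impI)
  fix n :: nat and s :: "nat list" and E
  assume n: "max 1 0 \<le> n" and s: "set s \<subseteq> {1..C}"
    and povm: "is_povm (basis_idx (length s) (2^n)) C E"
    and success: "\<forall>k\<in>{1..C}. success_prob C n s E k \<ge> 0.9"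
  let ?d = "2 ^ n :: nat" and ?G = "real (card (collision_free s (2 ^ n)))" and ?L = "\<lambda>k. class_sum s (2 ^ n) (E k)"
  define \<delta> where "\<delta> = 1 - 3 * (real (length s))\<^sup>2 / real ?d"
  have d: "2 \<le> ?d" using n self_le_power[of "2::nat" n] by simp
  have k: "1 \<in> {1..C}" "2 \<in> {1..C}" using assms by auto
  have W: "\<exists>W\<ge>0. \<delta> \<le> W * ?G \<and> (\<forall>k'\<in>{1..C}. 0 \<le> W * ?L k') \<and> W * (?G - ?L k) \<le> 0.1" if kC: "k \<in> {1..C}" for k
  proof -
    interpret refl_invariant_array "input_dist C ?d k" "{1..C}" ?d
      using d by (rule refl_invariant_array_input_dist)
    obtain W :: real where W: "0 \<le> W" "\<delta> \<le> W * ?G"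
      and nn: "\<forall>k'\<in>{1..C}. 0 \<le> W * ?L k'"
      and fail: "W * (?G - ?L k)
        \<le> 1 - (\<integral>X. outcome_prob (basis_idx (length s) ?d) E k (copies_state s X) \<partial>input_dist C ?d k)"
      unfolding \<delta>_def using povm_failure_ge[OF s povm kC] by blast
    have "(\<integral>X. outcome_prob (basis_idx (length s) ?d) E k (copies_state s X) \<partial>input_dist C ?d k) \<ge> 0.9"
      using success kC unfolding success_prob_def by blast
    then show ?thesis using W nn fail by (intro exI[of _ W] conjI) linarith+
  qed
  obtain W1 where W1: "W1 \<ge> 0" "\<delta> \<le> W1 * ?G" "\<forall>k'\<in>{1..C}. 0 \<le> W1 * ?L k'" "W1 * (?G - ?L 1) \<le> 0.1"
    using W[OF k(1)] by blast
  obtain W2 where W2: "W2 \<ge> 0" "\<delta> \<le> W2 * ?G" "W2 * (?G - ?L 2) \<le> 0.1"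
    using W[OF k(2)] by blast
  have "\<delta> \<le> 0.2"
  proof (rule ccontr)
    assume "\<not> \<delta> \<le> 0.2"
    then have \<delta>: "0.2 < \<delta>" by simp
    then have "W1 > 0" using W1 by (auto simp: less_le)
    \<comment> \<open>Class sums do not depend on the special index, so positivity obtained under
      index 1 holds for good. It allows the outcomes other than 1 and 2 to be dropped from the
      total.\<close>
    then have L: "0 \<le> ?L k'" if "k' \<in> {1..C}" for k'
      using W1(3) that by (auto simp: zero_le_mult_iff)
    interpret refl_invariant_array "input_dist C ?d 1" "{1..C}" ?d
      using d by (rule refl_invariant_array_input_dist)
    have "?L 1 + ?L 2 = (\<Sum>k\<in>{1, 2}. ?L k)" by simp
    also have "\<dots> \<le> (\<Sum>k\<in>{1..C}. ?L k)" using k L by (intro sum_mono2) auto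
    also have "\<dots> = ?G" using povm by (rule sum_class_sum_povm)
    finally show False
      using two_povm_bound[OF W1(1) W2(1) W1(2) W2(2) \<delta> W1(4) W2(3)] by blast
  qed
  then have "3 * (real (length s))\<^sup>2 \<ge> 0.8 * 2 ^ n"
    unfolding \<delta>_def by (simp add: field_simps)
  \<comment> \<open>Lowering \<open>0.8 / 3\<close> to \<open>1 / 4\<close> gives a rational square
    root, the constant \<open>c = 1 / 2\<close>.\<close>
  then have "2 ^ n \<le> 4 * (real (length s))\<^sup>2"
    using zero_le_power2[of "real (length s)"] by linarith
  moreover have "(2 powr (real n / 2))\<^sup>2 = (2::real) ^ n"
    by (simp add: powr_power powr_realpow)
  ultimately have "(2 powr (real n / 2))\<^sup>2 \<le> (2 * real (length s))\<^sup>2"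
    by (simp add: power_mult_distrib)
  then have "2 powr (real n / 2) \<le> 2 * real (length s)"
    by (rule power2_le_imp_le) simp
  then show "1 / 2 * 2 powr (real n / 2) \<le> real (length s)" by simp
qed simp

end
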